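(* Let $m,n$ be positive integers, $N=mn$, $g_{m,n}=m\binom n2-n+1$, and \[ \mathcal{D}_{m,n}=\Big\{(x_1,\dots,x_n)\in\mathbb{Z}^n : 0\le x_i\le N-1,\ \sum_{i=1}^n x_i\equiv g_{m,n}\pmod N\Big\}. \] Let $\mathrm{shift}(x_1,\dots,x_n)=(x_1+m,\dots,x_n+m)$ with entries reduced modulo $N$ into $\{0,\dots,N-1\}$, let $\sim$ be the equivalence relation on $\mathcal{D}_{m,n}$ given by $\mathbf x\sim\mathbf y$ iff $\mathbf y=\mathrm{shift}^j(\mathbf x)$ for some $j\in\mathbb{N}$, and let $\widehat{\mathcal{D}}_{m,n}=\mathcal{D}_{m,n}/\!\sim$, on which $S_n$ acts via its coordinate-permutation action on $\mathcal{D}_{m,n}$ (which commutes with shift). Let $S_n$ act on $\mathrm{Break}_{m,n}$ by permuting coordinates. Then: (1) the permutation representations $\mathbb{C}\mathrm{Break}_{m,n}$ and $\mathbb{C}\widehat{\mathcal{D}}_{m,n}$ of $S_n$ are isomorphic; (2) the number of $S_n$-orbits on $\mathrm{Break}_{m,n}$ equals the numerical Donaldson–Thomas invariant $\mathrm{DT}_n^{m+1}$ of the $(m+1)$-loop quiver, and \[ |S_n\backslash\widehat{\mathcal{D}}_{m,n}|=\frac{1}{n^2}\sum_{d\mid n}(-1)^{m(n+d)}\mu(n/d)\binom{(m+1)d-1}{md}, \] where $\mu$ is the number-theoretic Möbius function; (3) the restriction of $\mathbb{C}\mathrm{Break}_{m,n}$ to $S_{n-1}$ (the subgroup of permutations fixing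 $n$) is isomorphic to the permutation representation $\mathbb{C}\mathrm{Park}_{m,n}$ of $S_{n-1}$, where $S_{n-1}$ acts on $\mathrm{Park}_{m,n}$ by permuting coordinates.
   Context: $\mathrm{Break}_{m,n}$ is the set of break divisors on the complete multigraph $K_n^m$ (vertex set $[n]$, exactly $m$ edges between each pair of distinct vertices): vectors $D\in\mathbb{Z}_{\ge0}^n$ with entry sum $g_{m,n}$ such that $\sum_{v\in V(H)}D(v)\ge |E(H)|-|V(H)|+1$ for every induced subgraph $H$ of $K_n^m$. $\mathrm{Park}_{m,n}$ is the set of sequences $(d_1,\dots,d_{n-1})$ of nonnegative integers whose weakly increasing rearrangement $(\tilde d_1\le\cdots\le\tilde d_{n-1})$ satisfies $\tilde d_i\le mi-1$ for all $i$. The numerical Donaldson–Thomas invariants $\mathrm{DT}_n^{m+1}$ ($n\ge1$) of the $(m+1)$-loop quiver are defined by the (signed) Euler product factorization \[ \sum_{n\ge0}\frac{1}{mn+1}\binom{(m+1)n}{n}t^n=\prod_{n\ge1}\big(1-((-1)^m t)^n\big)^{-(-1)^{mn}\,n\,\mathrm{DT}_n^{m+1}} . \] *)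

theory Defs
  imports
    Complex_Main
    "HOL-Analysis.Infinite_Products"
    "HOL-Computational_Algebra.Computational_Algebra"
    "HOL-Number_Theory.Cong"
    "HOL-Algebra.Sym_Groups"
    "HOL-Algebra.Group_Action"
begin

section \<open>Permutation representations over the complex numbers\<close>

text \<open>
  For a set \<open>X\<close>, the vector space \<open>\<complex>X\<close> with basis \<open>X\<close> is the space of finitely supported functions
  on \<open>X\<close>, extended by \<open>0\<close> outside of \<open>X\<close>; the basis vector belonging to \<open>x\<close> is the indicator
  function of \<open>{x}\<close>.
\<close>

definition free_space :: "'a set \<Rightarrow> ('a \<Rightarrow> complex) set" where
  "free_space X = {f. finite {x. f x \<noteq> 0} \<and> {x. f x \<noteq> 0} \<subseteq> X}"

text \<open>
  The linear extension of an action \<open>\<phi>\<close> of \<open>G\<close> on \<open>X\<close>: since the indicator of \<open>x\<close> has to be sent to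
  the indicator of \<open>\<phi> g x\<close>, the function \<open>f\<close> is sent to \<open>x \<mapsto> f (g\<inverse> \<cdot> x)\<close>.
\<close>

definition perm_rep ::
  "('g, 'm) monoid_scheme \<Rightarrow> 'a set \<Rightarrow> ('g \<Rightarrow> 'a \<Rightarrow> 'a) \<Rightarrow> 'g \<Rightarrow> ('a \<Rightarrow> complex) \<Rightarrow> ('a \<Rightarrow> complex)"
  where "perm_rep G X \<phi> g f = (\<lambda>x. if x \<in> X then f (\<phi> (inv\<^bsub>G\<^esub> g) x) else 0)"

text \<open>
  Isomorphism of two representations \<open>\<rho>\<close> and \<open>\<sigma>\<close> of \<open>G\<close> on linear subspaces \<open>V\<close> and \<open>W\<close> of function
  spaces: a linear bijection that intertwines the two actions.
\<close>

definition reps_isomorphic ::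
  "('g, 'm) monoid_scheme \<Rightarrow>
   ('a \<Rightarrow> complex) set \<Rightarrow> ('g \<Rightarrow> ('a \<Rightarrow> complex) \<Rightarrow> ('a \<Rightarrow> complex)) \<Rightarrow>
   ('b \<Rightarrow> complex) set \<Rightarrow> ('g \<Rightarrow> ('b \<Rightarrow> complex) \<Rightarrow> ('b \<Rightarrow> complex)) \<Rightarrow> bool"
  where
  "reps_isomorphic G V \<rho> W \<sigma> \<longleftrightarrow>
     (\<exists>T. bij_betw T V W \<and>
          (\<forall>u\<in>V. \<forall>v\<in>V. T (\<lambda>x. u x + v x) = (\<lambda>y. T u y + T v y)) \<and>
          (\<forall>c. \<forall>u\<in>V. T (\<lambda>x. c * u x) = (\<lambda>y. c * T u y)) \<and>
          (\<forall>g\<in>carrier G. \<forall>u\<in>V. T (\<rho> g u) = \<sigma> g (T u)))"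


section \<open>Permutation of coordinates\<close>

text \<open>
  A vector of length \<open>n\<close> is a function that is extensional on \<open>{1..n}\<close>.  The left action of
  \<open>S\<^sub>n\<close> is \<open>(\<sigma> \<cdot> x)\<^sub>i = x\<^bsub>\<sigma>\<^sup>-\<^sup>1(i)\<^esub>\<close>, restricted to a set \<open>X\<close> of vectors.
\<close>

definition coord_action :: "(nat \<Rightarrow> int) set \<Rightarrow> (nat \<Rightarrow> nat) \<Rightarrow> (nat \<Rightarrow> int) \<Rightarrow> (nat \<Rightarrow> int)" where
  "coord_action X \<sigma> = (\<lambda>x\<in>X. x \<circ> inv' \<sigma>)"

text \<open>The induced action on a set \<open>Q\<close> of classes of vectors.\<close>

definition coord_action_classes ::
  "(nat \<Rightarrow> int) set set \<Rightarrow> (nat \<Rightarrow> nat) \<Rightarrow> (nat \<Rightarrow> int) set \<Rightarrow> (nat \<Rightarrow> int) set" where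
  "coord_action_classes Q \<sigma> = (\<lambda>C\<in>Q. (\<lambda>x. x \<circ> inv' \<sigma>) ` C)"


section \<open>Break divisors on complete multigraphs\<close>

text \<open>
  The edges of \<open>K\<^sub>n\<^sup>m\<close> within a vertex set \<open>S \<subseteq> {1..n}\<close>: the pair \<open>(e, k)\<close> is the \<open>k\<close>-th of the \<open>m\<close>
  parallel edges whose set of endpoints is \<open>e\<close>.
\<close>

definition multi_edges :: "nat \<Rightarrow> nat set \<Rightarrow> (nat set \<times> nat) set" where
  "multi_edges m S = {e. e \<subseteq> S \<and> card e = 2} \<times> {..<m}"

definition genus :: "nat \<Rightarrow> nat \<Rightarrow> int" where
  "genus m n = int m * int (n choose 2) - int n + 1"

text \<open>
  Induced subgraphs correspond to their vertex sets, which are nonempty (for the empty set, the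
  inequality would read \<open>0 \<ge> 1\<close>).
\<close>

definition Break :: "nat \<Rightarrow> nat \<Rightarrow> (nat \<Rightarrow> int) set" where
  "Break m n =
     {D \<in> {1..n} \<rightarrow>\<^sub>E {0..}.
        (\<Sum>v\<in>{1..n}. D v) = genus m n \<and>
        (\<forall>S. S \<noteq> {} \<and> S \<subseteq> {1..n} \<longrightarrow>
           (\<Sum>v\<in>S. D v) \<ge> int (card (multi_edges m S)) - int (card S) + 1)}"


section \<open>Parking functions\<close>

text \<open>The list \<open>sort (map d [1..<n])\<close> is indexed from \<open>0\<close>.\<close>

definition Park :: "nat \<Rightarrow> nat \<Rightarrow> (nat \<Rightarrow> int) set" where
  "Park m n =
     {d \<in> {1..n-1} \<rightarrow>\<^sub>E {0..}.
        \<forall>i\<in>{1..n-1}. sort (map d [1..<n]) ! (i - 1) \<le> int m * int i - 1}"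


section \<open>The set \<open>D\<close> and its quotient by the shift\<close>

definition Dset :: "nat \<Rightarrow> nat \<Rightarrow> (nat \<Rightarrow> int) set" where
  "Dset m n =
     {x \<in> {1..n} \<rightarrow>\<^sub>E {0..int (m * n) - 1}. [(\<Sum>i\<in>{1..n}. x i) = genus m n] (mod int (m * n))}"

definition shift :: "nat \<Rightarrow> nat \<Rightarrow> (nat \<Rightarrow> int) \<Rightarrow> (nat \<Rightarrow> int)" where
  "shift m n x = (\<lambda>i\<in>{1..n}. (x i + int m) mod int (m * n))"

definition shift_rel :: "nat \<Rightarrow> nat \<Rightarrow> ((nat \<Rightarrow> int) \<times> (nat \<Rightarrow> int)) set" where
  "shift_rel m n =
     {(x, y). x \<in> Dset m n \<and> y \<in> Dset m n \<and> (\<exists>j. y = (shift m n ^^ j) x)}"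

definition Dhat :: "nat \<Rightarrow> nat \<Rightarrow> (nat \<Rightarrow> int) set set" where
  "Dhat m n = Dset m n // shift_rel m n"


section \<open>The Moebius function and numerical Donaldson--Thomas invariants\<close>

definition moebius_mu :: "nat \<Rightarrow> int" where
  "moebius_mu n = (if squarefree n then (-1) ^ card (prime_factors n) else 0)"

text \<open>
  The power \<open>(1 - u)\<^sup>c\<close> of formal power series for a rational exponent \<open>c\<close>, given by the binomial
  series; it is meant for \<open>u\<close> without constant term.
\<close>

definition one_minus_powr :: "rat fps \<Rightarrow> rat \<Rightarrow> rat fps" where
  "one_minus_powr u c = fps_compose (fps_binomial c) (- u)"

text \<open>
  \<open>numerical_DT m n\<close> is the invariant \<open>DT\<^sub>n\<^sup>(\<^sup>m\<^sup>+\<^sup>1\<^sup>)\<close> of the quiver with \<open>m + 1\<close> loops.  A priori the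
  Euler product determines rational numbers; they turn out to be integers.  Only the values for
  \<open>n \<ge> 1\<close> are determined by it, so the value at \<open>0\<close> is fixed to be \<open>0\<close>.  Convergence of the product
  refers to the metric on formal power series, i.e. to the stabilisation of all coefficients.
\<close>

definition is_numerical_DT :: "nat \<Rightarrow> (nat \<Rightarrow> rat) \<Rightarrow> bool" where
  "is_numerical_DT m a \<longleftrightarrow>
     (\<lambda>k. let n = Suc k in
        one_minus_powr ((fps_const ((-1) ^ m) * fps_X) ^ n) (- ((-1) ^ (m * n) * of_nat n * a n)))
     has_prod
     Abs_fps (\<lambda>n. 1 / of_nat (m * n + 1) * of_nat (((m + 1) * n) choose n))"

definition numerical_DT :: "nat \<Rightarrow> nat \<Rightarrow> rat" where
  "numerical_DT m = (THE a. a 0 = 0 \<and> is_numerical_DT m a)"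


section \<open>Well-definedness of the actions\<close>

lemma carrier_sym_group_pred:
  assumes "n \<ge> 1"
  shows "carrier (sym_group (n - 1)) = {\<sigma> \<in> carrier (sym_group n). \<sigma> n = n}"
proof -
  have *: "{1..n} - {1..n-1} = {n}" "{1..n-1} \<subseteq> {1..n}" using assms by auto
  have "\<sigma> permutes {1..n-1} \<longleftrightarrow> \<sigma> permutes {1..n} \<and> \<sigma> n = n" for \<sigma>
  proof
    assume a: "\<sigma> permutes {1..n-1}"
    have "\<sigma> n = n" using a by (rule permutes_not_in) (use assms in auto)
    with a show "\<sigma> permutes {1..n} \<and> \<sigma> n = n"
      using permutes_subset *(2) by blast
  next
    assume a: "\<sigma> permutes {1..n} \<and> \<sigma> n = n"
    show "\<sigma> permutes {1..n-1}"
    proof (rule permutes_superset)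
      show "\<sigma> permutes {1..n}" using a by blast
      show "\<sigma> x = x" if "x \<in> {1..n} - {1..n-1}" for x
        using a that unfolding *(1) by simp
    qed
  qed
  then show ?thesis by (simp only: set_eq_iff mem_Collect_eq sym_group_carrier simp_thms)
qed

lemma group_action_sym_groupI:
  assumes cl: "\<And>\<sigma> x. \<sigma> permutes {1..n} \<Longrightarrow> x \<in> X \<Longrightarrow> h \<sigma> x \<in> X"
    and id: "\<And>x. x \<in> X \<Longrightarrow> h id x = x"
    and comp: "\<And>\<sigma> \<tau> x. \<sigma> permutes {1..n} \<Longrightarrow> \<tau> permutes {1..n} \<Longrightarrow> x \<in> X \<Longrightarrow>
                 h (\<sigma> \<circ> \<tau>) x = h \<sigma> (h \<tau> x)"
  shows "group_action (sym_group n) X (\<lambda>\<sigma>. \<lambda>x\<in>X. h \<sigma> x)"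
proof -
  have bij: "(\<lambda>x\<in>X. h \<sigma> x) \<in> Bij X" if s: "\<sigma> permutes {1..n}" for \<sigma>
  proof -
    have i: "inv' \<sigma> permutes {1..n}" using s by (rule permutes_inv)
    have 1: "h (inv' \<sigma>) (h \<sigma> x) = x" if "x \<in> X" for x
      using comp[OF i s that] id[OF that] permutes_inv_o(2)[OF s] by simp
    have 2: "h \<sigma> (h (inv' \<sigma>) x) = x" if "x \<in> X" for x
      using comp[OF s i that] id[OF that] permutes_inv_o(1)[OF s] by simp
    have "bij_betw (h \<sigma>) X X"
      by (rule bij_betwI[where g = "h (inv' \<sigma>)"]) (use 1 2 cl s i in auto)
    then show ?thesis by (simp add: Bij_def cong: bij_betw_cong)
  qed
  show ?thesis
    unfolding group_action_def group_hom_def group_hom_axioms_def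
  proof (intro conjI sym_group_is_group group_BijGroup homI)
    fix \<sigma> assume "\<sigma> \<in> carrier (sym_group n)"
    then show "(\<lambda>x\<in>X. h \<sigma> x) \<in> carrier (BijGroup X)"
      using bij by (simp add: BijGroup_def sym_group_carrier)
  next
    fix \<sigma> \<tau> assume "\<sigma> \<in> carrier (sym_group n)" "\<tau> \<in> carrier (sym_group n)"
    then have s: "\<sigma> permutes {1..n}" "\<tau> permutes {1..n}" by (auto simp: sym_group_carrier)
    show "(\<lambda>x\<in>X. h (\<sigma> \<otimes>\<^bsub>sym_group n\<^esub> \<tau>) x) =
            (\<lambda>x\<in>X. h \<sigma> x) \<otimes>\<^bsub>BijGroup X\<^esub> (\<lambda>x\<in>X. h \<tau> x)"
      using bij[OF s(1)] bij[OF s(2)] cl[OF s(2)] comp[OF s]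
      by (auto simp: BijGroup_def sym_group_mult compose_def fun_eq_iff)
  qed
qed

lemma inv_comp_permutes:
  assumes "\<sigma> permutes A" "\<tau> permutes A"
  shows "x \<circ> inv' (\<sigma> \<circ> \<tau>) = (x \<circ> inv' \<tau>) \<circ> inv' \<sigma>"
  using assms by (simp add: o_inv_distrib permutes_bij comp_assoc)

lemma group_action_coord:
  assumes "\<And>\<sigma> x. \<sigma> permutes {1..n} \<Longrightarrow> x \<in> X \<Longrightarrow> x \<circ> \<sigma> \<in> X"
  shows "group_action (sym_group n) X (coord_action X)"
proof -
  have "coord_action X = (\<lambda>\<sigma>. \<lambda>x\<in>X. x \<circ> inv' \<sigma>)" by (simp add: coord_action_def fun_eq_iff)
  moreover have "group_action (sym_group n) X (\<lambda>\<sigma>. \<lambda>x\<in>X. x \<circ> inv' \<sigma>)"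
    by (rule group_action_sym_groupI)
      (simp_all add: inv_comp_permutes assms permutes_inv del: One_nat_def)
  ultimately show ?thesis by simp
qed

lemma PiE_comp_permutes:
  assumes "\<sigma> permutes A" "x \<in> A \<rightarrow>\<^sub>E B"
  shows "x \<circ> \<sigma> \<in> A \<rightarrow>\<^sub>E B"
  using assms by (auto simp: PiE_def Pi_def extensional_def permutes_in_image)

lemma sum_comp_permutes:
  assumes "\<sigma> permutes A"
  shows "(\<Sum>i\<in>S. (x \<circ> \<sigma>) i) = (\<Sum>i\<in>\<sigma> ` S. x i)"
  using permutes_inj_on[OF assms, of S] by (simp add: sum.reindex)

lemma card_multi_edges:
  assumes "finite S"
  shows "card (multi_edges m S) = m * (card S choose 2)"
  using n_subsets[OF assms, of 2] by (simp add: multi_edges_def card_cartesian_product)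

lemma genus_eq: "genus m n = int (card (multi_edges m {1..n})) - int n + 1"
  by (simp add: genus_def card_multi_edges)

lemma group_action_Break: "group_action (sym_group n) (Break m n) (coord_action (Break m n))"
proof (rule group_action_coord)
  fix \<sigma> x assume s: "\<sigma> permutes {1..n}" and x: "x \<in> Break m n"
  have ineq: "(\<Sum>v\<in>S. x v) \<ge> int (card (multi_edges m S)) - int (card S) + 1"
    if "S \<noteq> {}" "S \<subseteq> {1..n}" for S
    using x that by (simp add: Break_def)
  have "(\<Sum>v\<in>S. (x \<circ> \<sigma>) v) \<ge> int (card (multi_edges m S)) - int (card S) + 1"
    if S: "S \<noteq> {}" "S \<subseteq> {1..n}" for S
  proof -
    have "\<sigma> ` S \<noteq> {}" "\<sigma> ` S \<subseteq> {1..n}"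
      using S permutes_image[OF s] by auto
    then have "(\<Sum>v\<in>\<sigma> ` S. x v) \<ge>
        int (card (multi_edges m (\<sigma> ` S))) - int (card (\<sigma> ` S)) + 1"
      by (rule ineq)
    moreover have "card (\<sigma> ` S) = card S"
      by (rule card_image, rule permutes_inj_on[OF s])
    moreover have "finite S" using S finite_subset by blast
    ultimately show ?thesis
      unfolding sum_comp_permutes[OF s] by (simp add: card_multi_edges)
  qed
  moreover have "(\<Sum>v\<in>{1..n}. (x \<circ> \<sigma>) v) = genus m n"
    using x unfolding sum_comp_permutes[OF s] permutes_image[OF s] Break_def by simp
  moreover have "x \<circ> \<sigma> \<in> {1..n} \<rightarrow>\<^sub>E {0..}"
    using x by (intro PiE_comp_permutes[OF s]) (simp add: Break_def)
  ultimately show "x \<circ> \<sigma> \<in> Break m n"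
    by (simp add: Break_def)
qed

lemma Dset_comp_permutes:
  assumes s: "\<sigma> permutes {1..n}" and x: "x \<in> Dset m n"
  shows "x \<circ> \<sigma> \<in> Dset m n"
proof -
  have "(\<Sum>v\<in>{1..n}. (x \<circ> \<sigma>) v) = (\<Sum>v\<in>{1..n}. x v)"
    unfolding sum_comp_permutes[OF s] permutes_image[OF s] by simp
  then show ?thesis using x PiE_comp_permutes[OF s] unfolding Dset_def by auto
qed

lemma group_action_Dset: "group_action (sym_group n) (Dset m n) (coord_action (Dset m n))"
  by (rule group_action_coord) (rule Dset_comp_permutes)

lemma group_action_Park:
  "group_action (sym_group (n - 1)) (Park m n) (coord_action (Park m n))"
proof (rule group_action_coord)
  fix \<sigma> x assume s: "\<sigma> permutes {1..n-1}" and x: "x \<in> Park m n"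
  have set: "{1..n-1} = set [1..<n]" by auto
  have "mset (map \<sigma> [1..<n]) = mset [1..<n]"
    using s unfolding set
    by (metis bij_betw_def distinct_map distinct_upt image_set permutes_imp_bij set_eq_iff_mset_eq_distinct)
  then have "mset (map (x \<circ> \<sigma>) [1..<n]) = mset (map x [1..<n])"
    by (metis map_map mset_map)
  then have "sort (map (x \<circ> \<sigma>) [1..<n]) = sort (map x [1..<n])"
    by (metis properties_for_sort mset_sort sorted_sort)
  then show "x \<circ> \<sigma> \<in> Park m n"
    using x PiE_comp_permutes[OF s] unfolding Park_def by auto
qed

lemma shift_comp_permutes:
  assumes "\<sigma> permutes {1..n}"
  shows "shift m n (x \<circ> \<sigma>) = shift m n x \<circ> \<sigma>"
  using permutes_in_image[OF assms] by (auto simp: shift_def fun_eq_iff restrict_def)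

lemma shift_pow_comp_permutes:
  assumes "\<sigma> permutes {1..n}"
  shows "(shift m n ^^ j) (x \<circ> \<sigma>) = (shift m n ^^ j) x \<circ> \<sigma>"
proof (induction j)
  case (Suc j)
  then show ?case by (simp only: funpow.simps comp_apply[of "shift m n"] shift_comp_permutes[OF assms])
qed simp

lemma shift_pow:
  assumes "x \<in> Dset m n"
  shows "(shift m n ^^ j) x = (\<lambda>i\<in>{1..n}. (x i + int (j * m)) mod int (m * n))"
proof (induction j)
  case 0
  show ?case using assms by (auto simp: Dset_def fun_eq_iff PiE_def extensional_def Pi_def)
next
  case (Suc j)
  then show ?case by (auto simp: shift_def fun_eq_iff algebra_simps mod_simps)
qed

lemma equiv_shift_rel: "equiv (Dset m n) (shift_rel m n)"
proof (rule equivI)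
  show "refl_on (Dset m n) (shift_rel m n)"
    unfolding refl_on_def shift_rel_def by (auto intro: exI[of _ 0])
  show "shift_rel m n \<subseteq> Dset m n \<times> Dset m n" by (auto simp: shift_rel_def)
  show "trans (shift_rel m n)"
    unfolding trans_def shift_rel_def by clarsimp (metis comp_apply funpow_add)
  show "sym (shift_rel m n)"
  proof (rule symI)
    fix x y assume "(x, y) \<in> shift_rel m n"
    then obtain j where x: "x \<in> Dset m n" and y: "y \<in> Dset m n" and j: "y = (shift m n ^^ j) x"
      by (auto simp: shift_rel_def)
    let ?k = "j * n - j"
    have "(shift m n ^^ ?k) y = x"
    proof
      fix i
      show "(shift m n ^^ ?k) y i = x i"
      proof (cases "i \<in> {1..n}")
        case False
        then show ?thesis using x by (auto simp: shift_pow[OF y] Dset_def PiE_def extensional_def)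
      next
        case True
        then have "j * n \<ge> j" by auto
        then have "?k + j = j * n" by simp
        then have "?k * m + j * m = j * (m * n)" by (metis add_mult_distrib mult.assoc mult.commute)
        then have "int (j * m) + int (?k * m) = int (m * n) * int j"
          by (metis add.commute mult.commute of_nat_add of_nat_mult)
        then have "(x i + int (j * m) + int (?k * m)) mod int (m * n) = x i mod int (m * n)"
          by (metis add.assoc mod_mult_self2)
        moreover have yi: "y i = (x i + int (j * m)) mod int (m * n)"
          using True unfolding j shift_pow[OF x] by simp
        moreover have "x i mod int (m * n) = x i"
          using x True by (intro mod_pos_pos_trivial) (auto simp: Dset_def PiE_def Pi_def)
        ultimately show ?thesis
          using True by (simp add: shift_pow[OF y] yi mod_simps del: of_nat_mult)
      qed
    qed
    then show "(y, x) \<in> shift_rel m n"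
      using x y unfolding shift_rel_def by force
  qed
qed

lemma Dhat_comp_permutes:
  assumes s: "\<sigma> permutes {1..n}" and C: "C \<in> Dhat m n"
  shows "(\<lambda>x. x \<circ> \<sigma>) ` C \<in> Dhat m n"
proof -
  obtain x where x: "x \<in> Dset m n" and Cx: "C = shift_rel m n `` {x}"
    using C unfolding Dhat_def quotient_def by auto
  have "(\<lambda>x. x \<circ> \<sigma>) ` C = shift_rel m n `` {x \<circ> \<sigma>}"
  proof (intro equalityI subsetI)
    fix z assume "z \<in> (\<lambda>x. x \<circ> \<sigma>) ` C"
    then show "z \<in> shift_rel m n `` {x \<circ> \<sigma>}"
      unfolding Cx shift_rel_def using Dset_comp_permutes[OF s]
      by (auto simp: shift_pow_comp_permutes[OF s])
  next
    fix z assume "z \<in> shift_rel m n `` {x \<circ> \<sigma>}"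
    then obtain j where z: "z \<in> Dset m n" "z = (shift m n ^^ j) x \<circ> \<sigma>"
      by (auto simp: shift_rel_def shift_pow_comp_permutes[OF s])
    have "(shift m n ^^ j) x = z \<circ> inv' \<sigma>"
      using z(2) permutes_inv_o(1)[OF s] by (simp add: comp_assoc)
    then have "(shift m n ^^ j) x \<in> Dset m n"
      using Dset_comp_permutes[OF permutes_inv[OF s] z(1)] by simp
    then show "z \<in> (\<lambda>x. x \<circ> \<sigma>) ` C"
      using z(2) x unfolding Cx shift_rel_def by auto
  qed
  then show ?thesis
    using Dset_comp_permutes[OF s x] unfolding Dhat_def by (simp add: quotientI)
qed

lemma group_action_Dhat:
  "group_action (sym_group n) (Dhat m n) (coord_action_classes (Dhat m n))"
proof -
  have "coord_action_classes (Dhat m n) = (\<lambda>\<sigma>. \<lambda>C\<in>Dhat m n. (\<lambda>x. x \<circ> inv' \<sigma>) ` C)"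
    by (simp add: coord_action_classes_def fun_eq_iff)
  moreover have "group_action (sym_group n) (Dhat m n)
      (\<lambda>\<sigma>. \<lambda>C\<in>Dhat m n. (\<lambda>x. x \<circ> inv' \<sigma>) ` C)"
    by (rule group_action_sym_groupI)
      (simp_all add: inv_comp_permutes image_image Dhat_comp_permutes permutes_inv del: One_nat_def)
  ultimately show ?thesis by simp
qed

end

theory Submission
  imports Defs
begin

text \<open>
  Reduction modulo \<open>N\<close> identifies the divisors of degree \<open>g\<close> on \<open>K\<^sub>n\<^sup>m\<close> modulo linear equivalence,
  \<open>S\<^sub>n\<close>-equivariantly, with the shift classes: the Laplacian lattice is generated by the vectors
  \<open>N e\<^sub>i - m (1, \<dots>, 1)\<close>.  Each class contains exactly one break divisor, its vector of minimal Euclidean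
  norm, and exactly one divisor reduced at the vertex \<open>n\<close>, that is, a parking function completed to
  degree \<open>g\<close>.  So both isomorphisms of representations come from equivariant bijections.

  The shift acts freely on the multisets of size \<open>n\<close> in \<open>\<int>/N\<close> with sum \<open>g\<close>, and a count by roots of
  unity, in which Ramanujan sums reduce to the Moebius function, gives the number of orbits.
  By Moebius inversion this is the recursion for the invariants read off from the logarithmic
  derivative of the Euler product.  The left-hand side \<open>F\<close> of that product satisfies
  \<open>t F' = F H\<close>, where \<open>H\<close> has the coefficients \<open>binomial((m + 1) n - 1, n - 1)\<close> for \<open>n \<ge> 1\<close>, by the
  Rothe-Hagen identity.
\<close>

unbundle no vec_syntax

section \<open>Moebius inversion and the Euler product\<close>

text \<open>No explicit map between break divisors and parking functions is constructed: both are
  matched with the same classes, and the two matchings are composed. The Euclidean norm is invariant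
  under all of S_n, so the first matching respects the full action; reducedness singles out the
  vertex n, so the second respects only its stabiliser, which is why the comparison with parking
  functions needs the restriction to S_{n-1}.

  The denominator n^2 has two sources. A filter over all N characters of \<int>/N contributes a
  factor N = m n, whose m cancels against binomial((m + 1) d - 1, d) = m binomial((m + 1) d - 1, m
  d); freeness of the shift contributes the other n. That freeness rests on the constant 1 in g. The
  signs come from the summand m binomial(n, 2) of g, since a primitive n-th root of unity raised to
  binomial(n, 2) is (-1)^(n-1).

  On the side of the invariants, comparing logarithmic derivatives turns an infinite product with
  unknown exponents into a linear system that is triangular with respect to divisibility. This gives
  uniqueness, without which the definite description of the invariants would say nothing.\<close>

lemma sum_moebius_mu_divisors:
  assumes "n > 0"
  shows "(\<Sum>d | d dvd n. moebius_mu d) = (if n = 1 then 1 else 0)"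
proof (cases "n = 1")
  case True
  then show ?thesis by (simp add: moebius_mu_def)
next
  case False
  then obtain p where p: "prime p" "p dvd n"
    using prime_factor_nat by blast
  \<comment> \<open>The squarefree divisors of n are the elements of \<open>D\<close> and their
    multiples by p; passing from d to p * d flips the sign of \<open>moebius_mu\<close>, so the
    contributions cancel in pairs.\<close>
  define D where "D = {d. d dvd n \<and> squarefree d \<and> \<not> p dvd d}"
  have fin: "finite {d. d dvd n}" using assms by simp
  then have finD: "finite D" by (rule finite_subset[rotated]) (auto simp: D_def)
  have cop: "coprime p d" if "d \<in> D" for d
    using that p by (auto simp: D_def prime_imp_coprime)
  have pd: "p * d dvd n" "squarefree (p * d)" if "d \<in> D" for d
    using that p cop[OF that]
    by (auto simp: D_def divides_mult squarefree_mult_coprime squarefree_prime)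
  have "(\<Sum>d | d dvd n. moebius_mu d) = (\<Sum>d\<in>D \<union> (*) p ` D. moebius_mu d)"
  proof (rule sum.mono_neutral_right[OF fin])
    show "D \<union> (*) p ` D \<subseteq> {d. d dvd n}" using pd by (auto simp: D_def)
    show "\<forall>i\<in>{d. d dvd n} - (D \<union> (*) p ` D). moebius_mu i = 0"
    proof
      fix i assume i: "i \<in> {d. d dvd n} - (D \<union> (*) p ` D)"
      have "\<not> squarefree i"
      proof
        assume sq: "squarefree i"
        with i have "p dvd i" by (auto simp: D_def)
        then obtain k where k: "i = p * k" by (elim dvdE)
        have "\<not> p dvd k"
        proof
          assume "p dvd k"
          then have "p ^ 2 dvd i" using k by (auto simp: power2_eq_square)
          then have "p dvd 1" using sq by (simp add: squarefree_def)
          then show False using p by simp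
        qed
        moreover have "squarefree k" using sq k
          by (meson squarefree_mono dvd_triv_right)
        moreover have "k dvd n" using i k by (auto intro: dvd_trans[OF dvd_triv_right])
        ultimately have "k \<in> D" by (simp add: D_def)
        then show False using i k by blast
      qed
      then show "moebius_mu i = 0" by (simp add: moebius_mu_def)
    qed
  qed
  also have "\<dots> = (\<Sum>d\<in>D. moebius_mu d) + (\<Sum>d\<in>(*) p ` D. moebius_mu d)"
    by (rule sum.union_disjoint) (use finD in \<open>auto simp: D_def\<close>)
  also have "(\<Sum>d\<in>(*) p ` D. moebius_mu d) = (\<Sum>d\<in>D. moebius_mu (p * d))"
    using p by (subst sum.reindex) (auto simp: inj_on_def)
  also have "\<dots> = (\<Sum>d\<in>D. - moebius_mu d)"
  proof (rule sum.cong[OF refl])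
    fix d assume d: "d \<in> D"
    then have d0: "d > 0" using assms by (auto simp: D_def intro: dvd_pos_nat)
    have "prime_factors (p * d) = insert p (prime_factors d)"
      using p d0 by (subst prime_factors_product) (auto simp: prime_prime_factors)
    moreover have "p \<notin> prime_factors d" using d by (auto simp: D_def)
    ultimately show "moebius_mu (p * d) = - moebius_mu d"
      using pd[OF d] d by (simp add: moebius_mu_def D_def)
  qed
  finally show ?thesis using False by (simp add: sum_negf)
qed

text \<open>After exchanging the sums, the coefficient of \<open>B d\<close> is the sum of
  \<open>moebius_mu\<close> over the divisors of \<open>n div d\<close>, which vanishes unless d =
  n.\<close>

lemma sum_dvd_moebius_sum:
  fixes f B :: "nat \<Rightarrow> 'a :: comm_ring_1"
  assumes f: "\<And>k. k > 0 \<Longrightarrow> f k = (\<Sum>d | d dvd k. of_int (moebius_mu (k div d)) * B d)"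
    and n: "n > 0"
  shows "(\<Sum>k | k dvd n. f k) = B n"
proof -
  have fin: "finite {k. k dvd n}" using n by simp
  have "(\<Sum>k | k dvd n. f k) =
      (\<Sum>k | k dvd n. \<Sum>d | d dvd n. if d dvd k then of_int (moebius_mu (k div d)) * B d else 0)"
  proof (rule sum.cong[OF refl])
    fix k assume "k \<in> {k. k dvd n}"
    then have k: "k dvd n" "k > 0" using n by (auto intro: dvd_pos_nat)
    have "{d. d dvd k} = {d \<in> {d. d dvd n}. d dvd k}" using k by (auto intro: dvd_trans)
    then show "f k = (\<Sum>d | d dvd n. if d dvd k then of_int (moebius_mu (k div d)) * B d else 0)"
      by (simp only: f[OF k(2)] sum.inter_filter[OF fin])
  qed
  also have "\<dots> = (\<Sum>d | d dvd n. \<Sum>k | k dvd n.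
      if d dvd k then of_int (moebius_mu (k div d)) * B d else 0)"
    by (rule sum.swap)
  also have "\<dots> = (\<Sum>d | d dvd n. if d = n then B d else 0)"
  proof (rule sum.cong[OF refl])
    fix d assume "d \<in> {d. d dvd n}"
    then have d: "d dvd n" "d > 0" using n by (auto intro: dvd_pos_nat)
    have nd: "n div d > 0" using d n by (metis dvd_div_eq_0_iff gr0I less_irrefl)
    have eq: "{k \<in> {k. k dvd n}. d dvd k} = (\<lambda>e. e * d) ` {e. e dvd n div d}"
    proof (intro equalityI subsetI)
      fix k assume "k \<in> {k \<in> {k. k dvd n}. d dvd k}"
      then show "k \<in> (\<lambda>e. e * d) ` {e. e dvd n div d}"
        using d by (intro image_eqI[where x = "k div d"]) (auto simp: div_dvd_div)
    next
      fix k assume "k \<in> (\<lambda>e. e * d) ` {e. e dvd n div d}"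
      then show "k \<in> {k \<in> {k. k dvd n}. d dvd k}"
        using d by (auto simp: dvd_div_iff_mult)
    qed
    have "(\<Sum>k | k dvd n. if d dvd k then of_int (moebius_mu (k div d)) * B d else 0)
        = (\<Sum>k\<in>(\<lambda>e. e * d) ` {e. e dvd n div d}. of_int (moebius_mu (k div d)) * B d)"
      unfolding eq[symmetric] by (rule sum.inter_filter[OF fin, symmetric])
    also have "\<dots> = (\<Sum>e | e dvd n div d. of_int (moebius_mu e) * B d)"
      using d by (subst sum.reindex) (auto simp: inj_on_def)
    also have "\<dots> = of_int (\<Sum>e | e dvd n div d. moebius_mu e) * B d"
      by (simp add: sum_distrib_right)
    also have "\<dots> = (if d = n then B d else 0)"
      unfolding sum_moebius_mu_divisors[OF nd] using d by (auto simp: dvd_div_eq_iff elim: dvdE)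
    finally show "(\<Sum>k | k dvd n. if d dvd k then of_int (moebius_mu (k div d)) * B d else 0)
        = (if d = n then B d else 0)" .
  qed
  also have "\<dots> = B n" using n fin by simp
  finally show ?thesis .
qed

text \<open>The value at \<open>k = 0\<close> is \<open>1\<close> also for \<open>a = 0\<close>, where the quotient is \<open>0 / 0\<close>.\<close>

definition raney :: "nat \<Rightarrow> nat \<Rightarrow> nat \<Rightarrow> rat" where
  "raney p a k =
     (if k = 0 then 1 else of_nat a / of_nat (a + p * k) * of_nat ((a + p * k) choose k))"

text \<open>\<open>raney p a k\<close> is the coefficient of X^k in the a-th power of the series B
  with B = 1 + X B^p. The recurrence is B^(a+1) = B^a + X B^(a+p), here verified on the closed
  form.\<close>

lemma raney_rec:
  assumes "p > 0"
  shows "raney p (Suc a) (Suc k) = raney p a (Suc k) + raney p (a + p) k"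
proof -
  \<comment> \<open>All three terms have upper index q or q + 1, so everything reduces to the two
    adjacent binomials \<open>c\<close> and \<open>c1\<close>.\<close>
  define q where "q = a + p * Suc k"
  have q: "q \<ge> Suc k" using mult_le_mono1[of 1 p "Suc k"] assms by (simp add: q_def)
  have qp: "rat_of_nat q > 0" using q by simp
  define c where "c = rat_of_nat (q choose k)"
  define c1 where "c1 = rat_of_nat (q choose Suc k)"
  have "Suc k * (q choose Suc k) = (q - k) * (q choose k)"
    using binomial_absorb_comp[of q k] binomial_absorption[of k "q"] q
    by (metis Suc_times_binomial_eq binomial_absorption binomial_absorb_comp mult.commute)
  then have 1: "rat_of_nat (Suc k) * c1 = (of_nat q - of_nat k) * c"
    using q unfolding c1_def c_def by (metis Suc_leD of_nat_diff of_nat_mult)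
  have 2: "rat_of_nat q = of_nat a + of_nat p * of_nat (Suc k)"
    by (simp add: q_def ring_distribs)
  have L: "raney p (Suc a) (Suc k) = (of_nat a + 1) / (of_nat q + 1) * (c + c1)"
    by (simp add: raney_def q_def c_def c1_def add_ac)
  have R1: "raney p a (Suc k) = of_nat a / of_nat q * c1"
    by (simp add: raney_def q_def c1_def)
  have R2: "raney p (a + p) k = (of_nat a + of_nat p) / of_nat q * c"
  proof (cases "k = 0")
    case True
    then show ?thesis using qp by (simp add: raney_def c_def q_def)
  next
    case False
    then show ?thesis by (simp add: raney_def c_def q_def add_ac)
  qed
  have c1: "c1 = (of_nat q - of_nat k) * c / of_nat (Suc k)"
    using 1 by (simp add: field_simps del: of_nat_Suc)
  have "(rat_of_nat a + 1) * of_nat q * (c + c1) * of_nat (Suc k) =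
     (of_nat q + 1) * (of_nat a * c1 + (of_nat a + of_nat p) * c) * of_nat (Suc k)"
  proof -
    have "(rat_of_nat a + 1) * of_nat q * (c + c1) * of_nat (Suc k) =
      (of_nat a + 1) * of_nat q * (of_nat (Suc k) * c + of_nat (Suc k) * c1)"
      by (simp only: algebra_simps)
    also have "\<dots> = (of_nat a + 1) * of_nat q * c * (of_nat q + 1)"
      unfolding 1 by (simp add: algebra_simps)
    also have "\<dots> = (of_nat q + 1) * (of_nat a * ((of_nat q - of_nat k) * c) +
        (of_nat a * of_nat (Suc k) + (of_nat q - of_nat a)) * c)"
      by (simp add: algebra_simps)
    also have "\<dots> = (of_nat q + 1) * (of_nat a * ((of_nat q - of_nat k) * c) +
        (of_nat a * of_nat (Suc k) + of_nat p * of_nat (Suc k)) * c)"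
      unfolding 2 by simp
    also have "\<dots> = (of_nat q + 1) * (of_nat a * c1 + (of_nat a + of_nat p) * c) * of_nat (Suc k)"
      unfolding 1[symmetric] by (simp only: algebra_simps)
    finally show ?thesis .
  qed
  then have "(rat_of_nat a + 1) * of_nat q * (c + c1) =
     (of_nat q + 1) * (of_nat a * c1 + (of_nat a + of_nat p) * c)"
    by (simp del: of_nat_Suc)
  then show ?thesis unfolding L R1 R2 using qp
    by (simp add: divide_simps) (simp add: algebra_simps)
qed

text \<open>The Rothe-Hagen identity. The outer induction keeps a arbitrary because
  \<open>raney_rec\<close> trades degree n + 1 at a + 1 for degree n + 1 at a and degree n at a + p;
  the right-hand sides then combine by Pascal's rule.\<close>

lemma sum_raney_binomial:
  assumes "p > 0"
  shows "(\<Sum>k\<le>n. raney p a k * of_nat ((b + p * (n - k)) choose (n - k))) =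
           of_nat ((a + b + p * n) choose n)"
proof (induction n arbitrary: a)
  case 0
  show ?case by (simp add: raney_def)
next
  case outer: (Suc n)
  show ?case
  proof (induction a)
    case 0
    have "(\<Sum>k\<le>Suc n. raney p 0 k * of_nat ((b + p * (Suc n - k)) choose (Suc n - k))) =
        (\<Sum>k\<le>Suc n. if k = 0 then of_nat ((b + p * Suc n) choose Suc n) else 0)"
      by (rule sum.cong) (simp_all add: raney_def)
    then show ?case by simp
  next
    case (Suc a)
    have 0: "raney p a 0 = 1" for a by (simp add: raney_def)
    have "(\<Sum>k\<le>Suc n. raney p (Suc a) k * of_nat ((b + p * (Suc n - k)) choose (Suc n - k))) =
       (\<Sum>k\<le>Suc n. raney p a k * of_nat ((b + p * (Suc n - k)) choose (Suc n - k))) +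
       (\<Sum>k\<le>n. raney p (a + p) k * of_nat ((b + p * (n - k)) choose (n - k)))"
      by (subst (1 2) sum.atMost_Suc_shift)
        (simp add: 0 raney_rec[OF assms] ring_distribs sum.distrib)
    also have "\<dots> = of_nat ((a + b + p * Suc n) choose Suc n) +
        of_nat ((a + p + b + p * n) choose n)"
      unfolding Suc outer ..
    also have "\<dots> = of_nat ((Suc a + b + p * Suc n) choose Suc n)"
      by (simp add: add_ac)
    finally show ?case .
  qed
qed

section \<open>Logarithmic derivatives of formal power series\<close>

text \<open>The equation X R' = R K with R(0) = 1 determines R and K from each other degree by
  degree. The version truncated at degree n is what applies to partial products, which agree with
  their limit only up to some degree.\<close>

lemma fps_log_deriv_agree:
  fixes P Q G H :: "'a :: field_char_0 fps"
  assumes P: "fps_X * fps_deriv P = P * G" "P $ 0 = 1"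
    and Q: "fps_X * fps_deriv Q = Q * H" "Q $ 0 = 1"
  shows "(\<forall>i\<le>n. P $ i = Q $ i) \<longleftrightarrow> (\<forall>i\<le>n. G $ i = H $ i)"
proof -
  have coeff: "of_nat i * R $ i = K $ i + (\<Sum>j\<in>{1..i}. R $ j * K $ (i - j))"
    if "fps_X * fps_deriv R = R * K" "R $ 0 = 1" for R K :: "'a fps" and i
  proof -
    have "(fps_X * fps_deriv R) $ i = of_nat i * R $ i" by (cases i) auto
    moreover have "(R * K) $ i = K $ i + (\<Sum>j\<in>{1..i}. R $ j * K $ (i - j))"
      by (simp add: fps_mult_nth sum.atLeast_Suc_atMost[of 0] that(2))
    ultimately show ?thesis using that(1) by simp
  qed
  have zero: "K $ 0 = 0" if "fps_X * fps_deriv R = R * K" "R $ 0 = 1" for R K :: "'a fps"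
    using coeff[OF that, of 0] by simp
  show ?thesis
  proof
    assume eq: "\<forall>i\<le>n. P $ i = Q $ i"
    have "i \<le> n \<Longrightarrow> G $ i = H $ i" for i
    proof (induction i rule: less_induct)
      case (less i)
      have "(\<Sum>j\<in>{1..i}. P $ j * G $ (i - j)) = (\<Sum>j\<in>{1..i}. Q $ j * H $ (i - j))"
        by (rule sum.cong) (use less eq in auto)
      then show ?case using coeff[OF P, of i] coeff[OF Q, of i] eq less.prems by simp
    qed
    then show "\<forall>i\<le>n. G $ i = H $ i" by blast
  next
    assume eq: "\<forall>i\<le>n. G $ i = H $ i"
    have "i \<le> n \<Longrightarrow> P $ i = Q $ i" for i
    proof (induction i rule: less_induct)
      case (less i)
      show ?case
      proof (cases "i = 0")
        case True
        then show ?thesis using P Q by simp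
      next
        case False
        have "(\<Sum>j\<in>{1..i}. P $ j * G $ (i - j)) = (\<Sum>j\<in>{1..i}. Q $ j * H $ (i - j))"
        proof (rule sum.cong[OF refl])
          fix j assume j: "j \<in> {1..i}"
          show "P $ j * G $ (i - j) = Q $ j * H $ (i - j)"
          \<comment> \<open>The term j = i contains the coefficient still to be compared, but its
            other factor is the constant term of G or H, which is 0.\<close>
          proof (cases "j = i")
            case True
            then show ?thesis using zero[OF P] zero[OF Q] by simp
          next
            case False
            then show ?thesis using j less eq by auto
          qed
        qed
        then have "of_nat i * P $ i = of_nat i * Q $ i"
          using coeff[OF P, of i] coeff[OF Q, of i] eq less.prems by simp
        then show ?thesis using False by simp
      qed
    qed
    then show "\<forall>i\<le>n. P $ i = Q $ i" by blast
  qed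
qed

text \<open>With u = (e X)^k, the logarithmic derivative of (1 - u)^c, multiplied by X, is - c k u /
  (1 - u), a geometric series supported on the positive multiples of k. Denominators are avoided by
  using the differential equation of the binomial series and cancelling 1 - u at the end.\<close>

lemma one_minus_powr_log_deriv:
  fixes e c :: rat
  assumes k: "k > 0"
  defines "f \<equiv> one_minus_powr ((fps_const e * fps_X) ^ k) c"
  shows "f $ 0 = 1"
    and "fps_X * fps_deriv f =
           f * Abs_fps (\<lambda>i. if i > 0 \<and> k dvd i then - c * of_nat k * e ^ i else 0)"
proof -
  define u where "u = (fps_const e * fps_X) ^ k"
  have u: "u = fps_const (e ^ k) * fps_X ^ k"
    by (simp add: u_def power_mult_distrib fps_const_power)
  have u0: "u $ 0 = 0" using k by (simp add: u_def fps_nth_power_0)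
  have f: "f = fps_compose (fps_binomial c) (- u)"
    by (simp add: f_def one_minus_powr_def u_def)
  show "f $ 0 = 1" by (simp add: f)
  define G where "G = Abs_fps (\<lambda>i. if i > 0 \<and> k dvd i then - c * of_nat k * e ^ i else 0)"
  have Xu: "fps_X * fps_deriv u = of_nat k * u"
  proof (rule fps_ext)
    fix i
    have "(fps_X * fps_deriv u) $ i = of_nat i * u $ i" by (cases i) auto
    also have "\<dots> = of_nat k * u $ i" by (simp add: u)
    finally show "(fps_X * fps_deriv u) $ i = (of_nat k * u) $ i"
      by (simp flip: fps_of_nat)
  qed
  have ode: "(1 + fps_X) * fps_deriv (fps_binomial c) = fps_const c * fps_binomial c"
    unfolding fps_binomial_deriv by (simp add: fps_divide_unit mult_ac inverse_mult_eq_1')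
  define B' where "B' = fps_compose (fps_deriv (fps_binomial c)) (- u)"
  have "fps_compose ((1 + fps_X) * fps_deriv (fps_binomial c)) (- u) = (1 - u) * B'"
    using u0 by (simp add: fps_compose_mult_distrib fps_compose_add_distrib B'_def)
  moreover have "fps_compose (fps_const c * fps_binomial c) (- u) = fps_const c * f"
    using u0 by (simp add: fps_compose_mult_distrib f)
  ultimately have 1: "(1 - u) * B' = fps_const c * f" by (simp add: ode)
  have 2: "fps_deriv f = B' * (- fps_deriv u)"
    unfolding f B'_def using u0 by (subst fps_compose_deriv) simp_all
  have "(1 - u) * (fps_X * fps_deriv f) = - (((1 - u) * B') * (fps_X * fps_deriv u))"
    unfolding 2 by (simp add: algebra_simps)
  also have "\<dots> = f * (- (fps_const c * of_nat k * u))"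
    unfolding 1 Xu by (simp add: algebra_simps)
  also have "- (fps_const c * of_nat k * u) = (1 - u) * G"
  proof (rule fps_ext)
    fix i
    have ui: "u $ i = (if i = k then e ^ k else 0)" for i by (simp add: u)
    have uG: "(u * G) $ i = (if i < k then 0 else e ^ k * G $ (i - k))"
      unfolding u by (simp add: mult.assoc fps_X_power_mult_nth)
    have "(- (fps_const c * of_nat k * u)) $ i = - c * of_nat k * u $ i"
      by (simp add: mult.assoc flip: fps_of_nat)
    also have "\<dots> = G $ i - (u * G) $ i"
    proof -
      consider "i < k" | "i = k" | "i > k" by linarith
      then show ?thesis
      proof cases
        case 1
        then have "\<not> (i > 0 \<and> k dvd i)" using dvd_imp_le by fastforce
        then show ?thesis using 1 unfolding uG ui by (auto simp: G_def)
      next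
        case 2
        then show ?thesis using k unfolding uG ui by (simp add: G_def)
      next
        case 3
        then have "k dvd i - k \<longleftrightarrow> k dvd i" by (simp add: dvd_minus_self)
        moreover have "e ^ k * e ^ (i - k) = e ^ i" using 3 by (simp flip: power_add)
        ultimately show ?thesis using 3 unfolding uG ui by (simp add: G_def algebra_simps)
      qed
    qed
    finally show "(- (fps_const c * of_nat k * u)) $ i = ((1 - u) * G) $ i"
      by (simp add: left_diff_distrib)
  qed
  finally have "(1 - u) * (fps_X * fps_deriv f) = (1 - u) * (f * G)"
    by (simp add: algebra_simps)
  moreover have "1 - u \<noteq> 0"
  proof
    assume "1 - u = 0"
    then have "(1 - u) $ 0 = 0" by simp
    then show False using u0 by simp
  qed
  ultimately show "fps_X * fps_deriv f =
           f * Abs_fps (\<lambda>i. if i > 0 \<and> k dvd i then - c * of_nat k * e ^ i else 0)"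
    by (simp add: G_def)
qed

lemma fps_log_deriv_prod:
  fixes f G :: "'i \<Rightarrow> 'a :: field fps"
  assumes "\<And>i. i \<in> A \<Longrightarrow> fps_X * fps_deriv (f i) = f i * G i"
  shows "fps_X * fps_deriv (prod f A) = prod f A * sum G A"
  using assms
proof (induction A rule: infinite_finite_induct)
  case (insert x A)
  have "fps_X * fps_deriv (prod f (insert x A)) =
      (fps_X * fps_deriv (f x)) * prod f A + f x * (fps_X * fps_deriv (prod f A))"
    using insert(1,2) by (simp add: ring_distribs mult_ac)
  also have "\<dots> = (f x * G x) * prod f A + f x * (prod f A * sum G A)"
    using insert by simp
  also have "\<dots> = prod f (insert x A) * sum G (insert x A)"
    using insert(1,2) by (simp add: algebra_simps)
  finally show ?case .
qed simp_all

text \<open>With p = m + 1, the coefficients of F are \<open>raney p 1 n\<close>, and p H + 1 is the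
  generating function of binomial(p n, n). Hence p F H + F is evaluated by
  \<open>sum_raney_binomial\<close> with a = 1 and b = 0.\<close>

lemma fuss_catalan_log_deriv:
  fixes m :: nat
  defines "F \<equiv> Abs_fps (\<lambda>n. 1 / of_nat (m * n + 1) * rat_of_nat (((m + 1) * n) choose n))"
    and "H \<equiv> Abs_fps (\<lambda>n. if n = 0 then 0 else rat_of_nat (((m + 1) * n - 1) choose (n - 1)))"
  shows "fps_X * fps_deriv F = F * H"
proof (rule fps_ext)
  fix n
  define p where "p = m + 1"
  have p: "p > 0" by (simp add: p_def)
  have F: "F $ n = raney p 1 n" for n
  proof (cases "n = 0")
    case True
    then show ?thesis by (simp add: F_def raney_def)
  next
    case False
    have "Suc (p * n) - n = m * n + 1" by (simp add: p_def)
    then have "(m * n + 1) * (Suc (p * n) choose n) = Suc (p * n) * ((p * n) choose n)"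
      using binomial_absorb_comp[of "Suc (p * n)" n] by simp
    then have "rat_of_nat (m * n + 1) * of_nat (Suc (p * n) choose n) =
        of_nat (Suc (p * n)) * of_nat ((p * n) choose n)"
      by (metis of_nat_mult)
    moreover have "rat_of_nat (m * n + 1) > 0" "rat_of_nat (Suc (p * n)) > 0"
      by (simp_all only: of_nat_0_less_iff)
    ultimately have "1 / rat_of_nat (m * n + 1) * of_nat ((p * n) choose n) =
        1 / of_nat (Suc (p * n)) * of_nat (Suc (p * n) choose n)"
      by (simp add: divide_simps del: of_nat_Suc of_nat_add of_nat_mult) (simp only: mult_ac)
    then show ?thesis using False unfolding F_def raney_def p_def by simp
  qed
  have H: "of_nat p * H $ j = of_nat ((p * j) choose j) - (if j = 0 then 1 else 0)" for j
  proof (cases j)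
    case 0
    then show ?thesis by (simp add: H_def)
  next
    case (Suc i)
    have "Suc i * ((p * j) choose j) = (p * j) * ((p * j - 1) choose i)"
      using binomial_absorption[of i "p * j"] Suc by simp
    then have "j * ((p * j) choose j) = j * (p * ((p * j - 1) choose (j - 1)))"
      using Suc by (simp only: mult_ac diff_Suc_1)
    then have "(p * j) choose j = p * ((p * j - 1) choose (j - 1))"
      by (metis Suc mult_left_cancel nat.distinct(1))
    then have "rat_of_nat ((p * j) choose j) = of_nat p * of_nat ((p * j - 1) choose (j - 1))"
      by (metis of_nat_mult)
    then show ?thesis using Suc by (simp add: H_def p_def)
  qed
  have "of_nat p * (F * H) $ n = (\<Sum>i\<le>n. raney p 1 i * (of_nat p * H $ (n - i)))"
    by (simp add: fps_mult_nth F sum_distrib_left atMost_atLeast0 mult_ac)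
  also have "\<dots> = (\<Sum>i\<le>n. raney p 1 i * of_nat ((0 + p * (n - i)) choose (n - i)))
      - (\<Sum>i\<le>n. if i = n then raney p 1 i else 0)"
    unfolding H sum_subtractf[symmetric] by (rule sum.cong) (auto simp: algebra_simps)
  also have "\<dots> = of_nat ((1 + p * n) choose n) - raney p 1 n"
    by (subst sum_raney_binomial[OF p]) simp
  also have "\<dots> = of_nat p * (of_nat n * raney p 1 n)"
  proof (cases "n = 0")
    case False
    define c where "c = rat_of_nat ((1 + p * n) choose n)"
    have "raney p 1 n = c / of_nat (1 + p * n)" using False by (simp add: raney_def c_def)
    moreover have "rat_of_nat (1 + p * n) > 0" by (simp only: of_nat_0_less_iff)
    ultimately show ?thesis unfolding c_def[symmetric]
      by (simp add: divide_simps) (simp add: algebra_simps)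
  qed (simp add: raney_def)
  finally have "(F * H) $ n = of_nat n * F $ n" using p F by simp
  moreover have "(fps_X * fps_deriv F) $ n = of_nat n * F $ n" by (cases n) auto
  ultimately show "(fps_X * fps_deriv F) $ n = (F * H) $ n" by simp
qed

text \<open>The n-th coefficient of the logarithmic derivative of the product collects one term from
  each factor whose index k divides n: one factor k comes from the exponent, the other from
  differentiating t^k.\<close>

lemma is_numerical_DT_iff:
  "is_numerical_DT m a \<longleftrightarrow>
     (\<forall>n>0. (\<Sum>k | k dvd n. (-1) ^ (m * (k + n)) * of_nat (k ^ 2) * a k) =
             rat_of_nat (((m + 1) * n - 1) choose (n - 1)))"
proof -
  define e where "e = ((-1) ^ m :: rat)"
  define f where "f k = one_minus_powr ((fps_const e * fps_X) ^ k)
      (- ((-1) ^ (m * k) * of_nat k * a k))" for k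
  define G where "G k = Abs_fps (\<lambda>i. if i > 0 \<and> k dvd i
      then - (- ((-1) ^ (m * k) * of_nat k * a k)) * of_nat k * e ^ i else 0)" for k
  define F where "F = Abs_fps (\<lambda>n. 1 / of_nat (m * n + 1) * rat_of_nat (((m + 1) * n) choose n))"
  define H where
    "H = Abs_fps (\<lambda>n. if n = 0 then 0 else rat_of_nat (((m + 1) * n - 1) choose (n - 1)))"
  define P where "P K = (\<Prod>i\<le>K. f (Suc i))" for K
  have F0: "F $ 0 = 1" by (simp add: F_def)
  then have Fnz: "F \<noteq> 0" by auto
  have FH: "fps_X * fps_deriv F = F * H" unfolding F_def H_def by (rule fuss_catalan_log_deriv)
  have P: "fps_X * fps_deriv (P K) = P K * (\<Sum>i\<le>K. G (Suc i))" for K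
    unfolding P_def G_def f_def by (rule fps_log_deriv_prod, rule one_minus_powr_log_deriv) simp
  have P0: "P K $ 0 = 1" for K
  proof -
    have "P K $ 0 = (\<Prod>i\<le>K. f (Suc i) $ 0)" unfolding P_def by (induction K) auto
    also have "\<dots> = 1" unfolding f_def
      by (simp add: one_minus_powr_log_deriv(1) del: power_Suc of_nat_Suc mult_Suc_right)
    finally show ?thesis .
  qed
  define S where "S n = (\<Sum>k | k dvd n. (-1) ^ (m * (k + n)) * of_nat (k ^ 2) * a k)" for n
  have G: "(\<Sum>i\<le>K. G (Suc i)) $ n = (if n = 0 then 0 else S n)" if "n \<le> K" for n K
  proof (cases "n = 0")
    case True
    then show ?thesis by (simp add: fps_sum_nth G_def)
  next
    case False
    have "(\<Sum>i\<le>K. G (Suc i)) $ n = (\<Sum>k\<in>Suc ` {..K}. G k $ n)"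
      by (simp add: fps_sum_nth sum.reindex)
    also have "\<dots> = (\<Sum>k | k dvd n. G k $ n)"
    proof (rule sum.mono_neutral_right)
      show "{k. k dvd n} \<subseteq> Suc ` {..K}"
      proof
        fix k assume "k \<in> {k. k dvd n}"
        then have "0 < k" "k \<le> n" using False by (auto intro: dvd_imp_le dvd_pos_nat)
        then show "k \<in> Suc ` {..K}" using that by (intro image_eqI[where x = "k - 1"]) auto
      qed
    qed (auto simp: G_def)
    also have "\<dots> = S n" unfolding S_def
      by (rule sum.cong)
        (use False in \<open>simp_all add: G_def e_def power2_eq_square power_add ring_distribs power_mult\<close>)
    finally show ?thesis using False by simp
  qed
  have "is_numerical_DT m a \<longleftrightarrow> (\<lambda>k. f (Suc k)) has_prod F"
    unfolding is_numerical_DT_def Let_def f_def F_def e_def by simp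
  \<comment> \<open>Since F is nonzero, the clause of \<open>has_prod\<close> for products with a
    vanishing factor cannot apply, and the nonvanishing required of the limit is automatic.\<close>
  also have "\<dots> \<longleftrightarrow> P \<longlonglongrightarrow> F"
    unfolding has_prod_def raw_has_prod_def P_def using Fnz by auto
  also have "\<dots> \<longleftrightarrow> (\<forall>n. \<forall>\<^sub>F K in sequentially. P K $ n = F $ n)"
    by (rule tendsto_fps_iff)
  \<comment> \<open>Agreement up to degree n is needed at a common K, because a coefficient of the
    logarithmic derivative depends on all lower coefficients of the series.\<close>
  also have "\<dots> \<longleftrightarrow> (\<forall>n. \<forall>\<^sub>F K in sequentially. \<forall>i\<le>n. P K $ i = F $ i)"
    (is "?L = ?R")
  proof
    assume L: ?L
    show ?R
    proof
      fix n
      have "\<forall>\<^sub>F K in sequentially. \<forall>i\<in>{..n}. P K $ i = F $ i"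
        by (rule eventually_ball_finite) (use L in auto)
      then show "\<forall>\<^sub>F K in sequentially. \<forall>i\<le>n. P K $ i = F $ i"
        by (rule eventually_mono) simp
    qed
  next
    assume R: ?R
    show ?L
    proof
      fix n
      show "\<forall>\<^sub>F K in sequentially. P K $ n = F $ n"
        using R[rule_format, of n] by (rule eventually_mono) simp
    qed
  qed
  also have "\<dots> \<longleftrightarrow> (\<forall>n. \<forall>\<^sub>F K in sequentially. \<forall>i\<le>n. (\<Sum>i\<le>K. G (Suc i)) $ i = H $ i)"
    by (simp only: fps_log_deriv_agree[OF P P0 FH F0])
  also have "\<dots> \<longleftrightarrow> (\<forall>n. \<forall>i\<le>n. (if i = 0 then 0 else S i) = H $ i)"
  proof (rule arg_cong[where f = All], rule ext)
    fix n
    define R where "R \<longleftrightarrow> (\<forall>i\<le>n. (if i = 0 then 0 else S i) = H $ i)"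
    have "\<forall>\<^sub>F K in sequentially. (\<forall>i\<le>n. (\<Sum>i\<le>K. G (Suc i)) $ i = H $ i) \<longleftrightarrow> R"
      unfolding R_def using eventually_ge_at_top[of n] by (rule eventually_mono) (simp add: G)
    then have "(\<forall>\<^sub>F K in sequentially. \<forall>i\<le>n. (\<Sum>i\<le>K. G (Suc i)) $ i = H $ i) \<longleftrightarrow>
        (\<forall>\<^sub>F K in sequentially. R)"
      by (rule eventually_subst)
    then show "(\<forall>\<^sub>F K in sequentially. \<forall>i\<le>n. (\<Sum>i\<le>K. G (Suc i)) $ i = H $ i) \<longleftrightarrow>
        (\<forall>i\<le>n. (if i = 0 then 0 else S i) = H $ i)"
      by (simp add: R_def[symmetric])
  qed
  also have "\<dots> \<longleftrightarrow> (\<forall>n>0. S n = rat_of_nat (((m + 1) * n - 1) choose (n - 1)))"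
    by (auto simp: H_def)
  finally show ?thesis unfolding S_def .
qed

text \<open>In the n-th equation of the linear system, \<open>a n\<close> has the coefficient n^2
  and all other unknowns have smaller index, so there is at most one solution with the prescribed
  value at 0.\<close>

lemma numerical_DT_eqI:
  assumes "a 0 = 0" "is_numerical_DT m a"
  shows "numerical_DT m = a"
  unfolding numerical_DT_def
proof (rule the_equality)
  show "a 0 = 0 \<and> is_numerical_DT m a" using assms by simp
next
  fix b assume b: "b 0 = 0 \<and> is_numerical_DT m b"
  have "b n = a n" for n
  proof (induction n rule: less_induct)
    case (less n)
    show ?case
    proof (cases "n = 0")
      case True
      then show ?thesis using b assms by simp
    next
      case False
      let ?t = "\<lambda>a k. (-1) ^ (m * (k + n)) * of_nat (k ^ 2) * a k"
      have split: "(\<Sum>k | k dvd n. ?t c k) = ?t c n + (\<Sum>k\<in>{k. k dvd n} - {n}. ?t c k)"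
        for c :: "nat \<Rightarrow> rat"
        using False by (intro sum.remove) auto
      have "(\<Sum>k\<in>{k. k dvd n} - {n}. ?t b k) = (\<Sum>k\<in>{k. k dvd n} - {n}. ?t a k)"
      proof (rule sum.cong[OF refl])
        fix k assume "k \<in> {k. k dvd n} - {n}"
        then have "k < n" using False by (auto dest!: dvd_imp_le)
        then show "?t b k = ?t a k" using less by simp
      qed
      moreover have "(\<Sum>k | k dvd n. ?t b k) = (\<Sum>k | k dvd n. ?t a k)"
        using b assms(2) False unfolding is_numerical_DT_iff by simp
      ultimately have "?t b n = ?t a n" unfolding split by simp
      then show ?thesis using False by simp
    qed
  qed
  then show "b = a" by (rule ext)
qed

section \<open>Permutation representations\<close>

text \<open>Functions are transported along \<beta>. The groups H and K only supply inverses and are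
  kept apart from G: for the restriction to the stabiliser of n, the inverse is taken in
  \<open>sym_group n\<close> on one side and in \<open>sym_group (n - 1)\<close> on the
  other.\<close>

lemma reps_isomorphic_perm_repI:
  fixes X :: "'b set" and Y :: "'c set"
  assumes bij: "bij_betw \<beta> X Y"
    and closed: "\<And>g x. g \<in> carrier G \<Longrightarrow> x \<in> X \<Longrightarrow> \<phi> (inv\<^bsub>H\<^esub> g) x \<in> X"
    and equivariant: "\<And>g x. g \<in> carrier G \<Longrightarrow> x \<in> X \<Longrightarrow>
      \<beta> (\<phi> (inv\<^bsub>H\<^esub> g) x) = \<psi> (inv\<^bsub>K\<^esub> g) (\<beta> x)"
  shows "reps_isomorphic G (free_space X) (perm_rep H X \<phi>) (free_space Y) (perm_rep K Y \<psi>)"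
proof -
  define \<gamma> where "\<gamma> = inv_into X \<beta>"
  have \<gamma>: "\<gamma> y \<in> X" "\<beta> (\<gamma> y) = y" if "y \<in> Y" for y
    using that bij unfolding \<gamma>_def by (auto simp: bij_betw_def inv_into_into f_inv_into_f)
  have \<beta>: "\<beta> x \<in> Y" "\<gamma> (\<beta> x) = x" if "x \<in> X" for x
    using that bij unfolding \<gamma>_def by (auto simp: bij_betw_def)
  define T where "T u = (\<lambda>y. if y \<in> Y then u (\<gamma> y) else 0)" for u :: "'b \<Rightarrow> complex"
  define T' where "T' v = (\<lambda>x. if x \<in> X then v (\<beta> x) else 0)" for v :: "'c \<Rightarrow> complex"
  have T_bij: "bij_betw T (free_space X) (free_space Y)"
  proof (rule bij_betwI[where g = T'])
    show "T \<in> free_space X \<rightarrow> free_space Y"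
    proof
      fix u :: "'b \<Rightarrow> complex" assume u: "u \<in> free_space X"
      have "{y. T u y \<noteq> 0} \<subseteq> \<beta> ` {x. u x \<noteq> 0}"
      proof
        fix y assume "y \<in> {y. T u y \<noteq> 0}"
        then have "y \<in> Y" "u (\<gamma> y) \<noteq> 0" by (auto simp: T_def split: if_splits)
        then show "y \<in> \<beta> ` {x. u x \<noteq> 0}"
          using \<gamma> by (intro image_eqI[where x = "\<gamma> y"]) auto
      qed
      then have "finite {y. T u y \<noteq> 0}"
        using u by (auto simp: free_space_def elim: finite_subset)
      then show "T u \<in> free_space Y"
        by (auto simp: free_space_def T_def split: if_splits)
    qed
    show "T' \<in> free_space Y \<rightarrow> free_space X"
    proof
      fix v :: "'c \<Rightarrow> complex" assume v: "v \<in> free_space Y"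
      have "{x. T' v x \<noteq> 0} \<subseteq> \<gamma> ` {y. v y \<noteq> 0}"
      proof
        fix x assume "x \<in> {x. T' v x \<noteq> 0}"
        then have "x \<in> X" "v (\<beta> x) \<noteq> 0" by (auto simp: T'_def split: if_splits)
        then show "x \<in> \<gamma> ` {y. v y \<noteq> 0}"
          using \<beta> by (intro image_eqI[where x = "\<beta> x"]) auto
      qed
      then have "finite {x. T' v x \<noteq> 0}"
        using v by (auto simp: free_space_def elim: finite_subset)
      then show "T' v \<in> free_space X"
        by (auto simp: free_space_def T'_def split: if_splits)
    qed
    show "T' (T u) = u" if "u \<in> free_space X" for u
      using that \<beta> by (auto simp: T_def T'_def free_space_def fun_eq_iff)
    show "T (T' v) = v" if "v \<in> free_space Y" for v
      using that \<gamma> by (auto simp: T_def T'_def free_space_def fun_eq_iff)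
  qed
  have T_perm_rep: "T (perm_rep H X \<phi> g u) = perm_rep K Y \<psi> g (T u)" if g: "g \<in> carrier G" for g u
  proof
    fix y
    show "T (perm_rep H X \<phi> g u) y = perm_rep K Y \<psi> g (T u) y"
    proof (cases "y \<in> Y")
      case True
      define x where "x = \<gamma> y"
      have x: "x \<in> X" "y = \<beta> x" using \<gamma>[OF True] by (simp_all add: x_def)
      have "T u (\<psi> (inv\<^bsub>K\<^esub> g) y) = T u (\<beta> (\<phi> (inv\<^bsub>H\<^esub> g) x))"
        using equivariant[OF g x(1)] x(2) by simp
      also have "\<dots> = u (\<phi> (inv\<^bsub>H\<^esub> g) x)"
        using \<beta>[OF closed[OF g x(1)]] by (simp add: T_def)
      finally show ?thesis using True x \<beta> by (simp add: perm_rep_def T_def)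
    qed (simp add: T_def perm_rep_def)
  qed
  have T_add: "T (\<lambda>x. u x + v x) = (\<lambda>y. T u y + T v y)" for u v
    by (rule ext) (simp add: T_def)
  have T_scale: "T (\<lambda>x. c * u x) = (\<lambda>y. c * T u y)" for c u
    by (rule ext) (simp add: T_def)
  show ?thesis unfolding reps_isomorphic_def
    by (intro exI[of _ T] conjI ballI allI T_bij T_add T_scale T_perm_rep)
qed

lemma card_orbits_eqI:
  assumes bij: "bij_betw \<beta> X Y"
    and closed: "\<And>g x. g \<in> carrier G \<Longrightarrow> x \<in> X \<Longrightarrow> \<phi> g x \<in> X"
    and equivariant: "\<And>g x. g \<in> carrier G \<Longrightarrow> x \<in> X \<Longrightarrow> \<beta> (\<phi> g x) = \<psi> g (\<beta> x)"
  shows "card (orbits G X \<phi>) = card (orbits G Y \<psi>)"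
proof (rule bij_betw_same_card)
  have "\<beta> ` orbit G \<phi> x = orbit G \<psi> (\<beta> x)" if "x \<in> X" for x
    unfolding orbit_def using equivariant[OF _ that] by (fastforce simp: image_iff)
  then have "(`) \<beta> ` orbit G \<phi> ` X = orbit G \<psi> ` \<beta> ` X"
    by (simp add: image_image)
  moreover have "orbits G X \<phi> = orbit G \<phi> ` X" "orbits G Y \<psi> = orbit G \<psi> ` Y"
    by (auto simp: orbits_def)
  moreover have "\<beta> ` X = Y" using bij by (simp add: bij_betw_def)
  ultimately have "orbits G Y \<psi> = (`) \<beta> ` orbits G X \<phi>" by simp
  moreover have "U \<subseteq> X" if "U \<in> orbits G X \<phi>" for U
    using that closed by (auto simp: orbits_def orbit_def)
  then have "inj_on ((`) \<beta>) (orbits G X \<phi>)"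
    using bij unfolding bij_betw_def by (meson inj_onI inj_on_image_eq_iff)
  ultimately show "bij_betw ((`) \<beta>) (orbits G X \<phi>) (orbits G Y \<psi>)"
    by (simp add: bij_betw_def)
qed

section \<open>Divisor classes on complete multigraphs\<close>

definition Deg :: "nat \<Rightarrow> nat \<Rightarrow> (nat \<Rightarrow> int) set" where
  "Deg m n = {D \<in> extensional {1..n}. (\<Sum>i\<in>{1..n}. D i) = genus m n}"

text \<open>
  Linear equivalence: the Laplacian of \<open>K\<^sub>n\<^sup>m\<close> sends \<open>f\<close> to \<open>i \<mapsto> m n f\<^sub>i - m \<Sum>\<^sub>j f\<^sub>j\<close>.
\<close>

definition lin_equiv :: "nat \<Rightarrow> nat \<Rightarrow> (nat \<Rightarrow> int) \<Rightarrow> (nat \<Rightarrow> int) \<Rightarrow> (nat \<Rightarrow> int) \<Rightarrow> bool" where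
  "lin_equiv m n f D D' \<longleftrightarrow>
     (\<forall>i\<in>{1..n}. D' i = D i + int (m * n) * f i - int m * (\<Sum>j\<in>{1..n}. f j))"

definition red :: "nat \<Rightarrow> nat \<Rightarrow> (nat \<Rightarrow> int) \<Rightarrow> (nat \<Rightarrow> int)" where
  "red m n D = (\<lambda>i\<in>{1..n}. D i mod int (m * n))"

text \<open>The linear equivalence class of D, named after the Picard group and realised as the
  shift class of the residues of D.\<close>

definition pic :: "nat \<Rightarrow> nat \<Rightarrow> (nat \<Rightarrow> int) \<Rightarrow> (nat \<Rightarrow> int) set" where
  "pic m n D = shift_rel m n `` {red m n D}"

lemma lin_equiv_trans:
  "lin_equiv m n f D D' \<Longrightarrow> lin_equiv m n g D' D'' \<Longrightarrow> lin_equiv m n (\<lambda>i. f i + g i) D D''"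
  unfolding lin_equiv_def by (simp add: distrib_left sum.distrib)

lemma lin_equiv_sym: "lin_equiv m n f D D' \<Longrightarrow> lin_equiv m n (\<lambda>i. - f i) D' D"
  by (simp add: lin_equiv_def algebra_simps sum_negf)

lemma lin_equiv_sum:
  assumes "lin_equiv m n f D D'"
  shows "(\<Sum>i\<in>{1..n}. D' i) = (\<Sum>i\<in>{1..n}. D i)"
proof -
  have "(\<Sum>i\<in>{1..n}. D' i) =
      (\<Sum>i\<in>{1..n}. D i + int (m * n) * f i - int m * (\<Sum>j\<in>{1..n}. f j))"
    using assms by (intro sum.cong) (auto simp: lin_equiv_def)
  then show ?thesis by (simp add: sum.distrib sum_subtractf flip: sum_distrib_left)
qed

lemma red_in_Dset:
  assumes "m \<ge> 1" "n \<ge> 1" "D \<in> Deg m n"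
  shows "red m n D \<in> Dset m n"
proof -
  have N: "int (m * n) > 0" using assms by (simp del: of_nat_mult)
  have "[(\<Sum>i\<in>{1..n}. red m n D i) = (\<Sum>i\<in>{1..n}. D i)] (mod int (m * n))"
    by (rule cong_sum) (simp add: red_def cong_def)
  moreover have "red m n D i \<le> int (m * n) - 1" if "i \<in> {1..n}" for i
    using pos_mod_bound[OF N, of "D i"] that by (simp add: red_def del: of_nat_mult)
  moreover have "red m n D i \<ge> 0" if "i \<in> {1..n}" for i
    using pos_mod_sign[OF N, of "D i"] that by (simp add: red_def del: of_nat_mult)
  moreover have "red m n D \<in> extensional {1..n}" by (simp add: red_def)
  ultimately show ?thesis
    using assms unfolding Dset_def Deg_def by (auto simp: PiE_def simp del: of_nat_mult)
qed

lemma pic_in_Dhat: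
  assumes "m \<ge> 1" "n \<ge> 1" "D \<in> Deg m n"
  shows "pic m n D \<in> Dhat m n"
  unfolding pic_def Dhat_def using red_in_Dset[OF assms] by (rule quotientI)

text \<open>Modulo m n, the Laplacian of f is the constant vector with entries - m times the sum of
  f, that is, a power of the shift. Conversely, equality of degrees makes the integer quotients of a
  congruence into a suitable f.\<close>

lemma pic_eq_iff:
  assumes mn: "m \<ge> 1" "n \<ge> 1" and D: "D \<in> Deg m n" and D': "D' \<in> Deg m n"
  shows "pic m n D = pic m n D' \<longleftrightarrow> (\<exists>f. lin_equiv m n f D D')"
proof -
  note r = red_in_Dset[OF mn D] red_in_Dset[OF mn D']
  have "pic m n D = pic m n D' \<longleftrightarrow> (red m n D, red m n D') \<in> shift_rel m n"
    unfolding pic_def using eq_equiv_class_iff[OF equiv_shift_rel] r by simp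
  also have "\<dots> \<longleftrightarrow> (\<exists>j. red m n D' = (shift m n ^^ j) (red m n D))"
    using r by (simp add: shift_rel_def)
  also have "\<dots> \<longleftrightarrow> (\<exists>j. \<forall>i\<in>{1..n}. [D' i = D i + int (j * m)] (mod int (m * n)))"
    unfolding shift_pow[OF r(1)]
    by (auto simp: red_def cong_def fun_eq_iff mod_simps)
  also have "\<dots> \<longleftrightarrow> (\<exists>f. lin_equiv m n f D D')"
  proof
    assume "\<exists>j. \<forall>i\<in>{1..n}. [D' i = D i + int (j * m)] (mod int (m * n))"
    then obtain j where j: "\<forall>i\<in>{1..n}. [D' i = D i + int (j * m)] (mod int (m * n))" ..
    have "\<forall>i\<in>{1..n}. \<exists>h. D' i = D i + int (j * m) + int (m * n) * h"
    proof
      fix i assume "i \<in> {1..n}"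
      then have "int (m * n) dvd D' i - (D i + int (j * m))"
        using j by (simp add: cong_iff_dvd_diff)
      then obtain h where "D' i - (D i + int (j * m)) = int (m * n) * h" by (elim dvdE)
      then have "D' i = D i + int (j * m) + int (m * n) * h" by linarith
      then show "\<exists>h. D' i = D i + int (j * m) + int (m * n) * h" ..
    qed
    then obtain h where h: "\<And>i. i \<in> {1..n} \<Longrightarrow> D' i = D i + int (j * m) + int (m * n) * h i"
      by metis
    have "(\<Sum>i\<in>{1..n}. D' i) = (\<Sum>i\<in>{1..n}. D i + int (j * m) + int (m * n) * h i)"
      using h by (rule sum.cong[OF refl])
    \<comment> \<open>Equal degrees force the quotients h to sum to -j, which is exactly the
      constant term in the Laplacian of h.\<close>
    then have "int (m * n) * (int j + (\<Sum>i\<in>{1..n}. h i)) = 0"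
      using D D' by (simp add: Deg_def sum.distrib algebra_simps flip: sum_distrib_left)
    then have "int j = - (\<Sum>i\<in>{1..n}. h i)" using mn by simp
    then have "lin_equiv m n h D D'"
      unfolding lin_equiv_def using h by (simp add: algebra_simps)
    then show "\<exists>f. lin_equiv m n f D D'" by blast
  next
    assume "\<exists>f. lin_equiv m n f D D'"
    then obtain f where f: "lin_equiv m n f D D'" ..
    define s where "s = (\<Sum>i\<in>{1..n}. f i)"
    \<comment> \<open>The shift exponent must be a natural number; replacing -s by its residue
      modulo n changes entries only by multiples of m n.\<close>
    define j where "j = nat ((- s) mod int n)"
    have j: "int j = - s + int n * (- ((- s) div int n))"
    proof -
      have "int j = (- s) mod int n" using mn by (simp add: j_def)
      then show ?thesis by (simp add: minus_mult_div_eq_mod[symmetric])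
    qed
    have "[D' i = D i + int (j * m)] (mod int (m * n))" if "i \<in> {1..n}" for i
    proof -
      have "D' i - (D i + int (j * m)) = int (m * n) * (f i + (- s) div int n)"
        using f that unfolding lin_equiv_def s_def[symmetric] of_nat_mult j
        by (simp add: algebra_simps)
      then show ?thesis unfolding cong_iff_dvd_diff by (metis dvd_triv_left)
    qed
    then show "\<exists>j. \<forall>i\<in>{1..n}. [D' i = D i + int (j * m)] (mod int (m * n))" by blast
  qed
  finally show ?thesis .
qed

lemma Dhat_eq_pic:
  assumes mn: "m \<ge> 1" "n \<ge> 1" and C: "C \<in> Dhat m n"
  obtains D where "D \<in> Deg m n" "C = pic m n D"
proof -
  obtain x where x: "x \<in> Dset m n" and Cx: "C = shift_rel m n `` {x}"
    using C unfolding Dhat_def quotient_def by auto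
  have "[genus m n = (\<Sum>i\<in>{1..n}. x i)] (mod int (m * n))"
    using x by (simp add: Dset_def cong_sym)
  then obtain t where t: "genus m n - (\<Sum>i\<in>{1..n}. x i) = int (m * n) * t"
    unfolding cong_iff_dvd_diff by (elim dvdE)
  \<comment> \<open>A vector of residues has the right degree only modulo m n; the first entry
    absorbs the defect without changing its residue.\<close>
  define D where "D = (\<lambda>i\<in>{1..n}. x i + (if i = 1 then int (m * n) * t else 0))"
  have "(\<Sum>i\<in>{1..n}. D i) = (\<Sum>i\<in>{1..n}. x i + (if i = 1 then int (m * n) * t else 0))"
    by (rule sum.cong) (simp_all add: D_def)
  also have "\<dots> = genus m n" using t mn by (simp add: sum.distrib del: of_nat_mult)
  finally have "D \<in> Deg m n" by (simp add: Deg_def D_def)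
  moreover have "red m n D = x"
    using x by (auto simp: red_def D_def fun_eq_iff Dset_def PiE_def extensional_def Pi_def
        intro!: mod_pos_pos_trivial)
  ultimately show thesis using that Cx by (simp add: pic_def)
qed

lemma pic_comp_permutes:
  assumes mn: "m \<ge> 1" "n \<ge> 1" and D: "D \<in> Deg m n" and s: "\<sigma> permutes {1..n}"
  shows "D \<circ> \<sigma> \<in> Deg m n" "pic m n (D \<circ> \<sigma>) = (\<lambda>x. x \<circ> \<sigma>) ` pic m n D"
proof -
  show "D \<circ> \<sigma> \<in> Deg m n"
    using D permutes_in_image[OF s] unfolding Deg_def
    by (auto simp: extensional_def sum_comp_permutes[OF s, unfolded comp_def]
        permutes_image[OF s, simplified])
  have red: "red m n (D \<circ> \<sigma>) = red m n D \<circ> \<sigma>"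
    using permutes_in_image[OF s] by (auto simp: red_def fun_eq_iff restrict_def)
  let ?C = "(\<lambda>x. x \<circ> \<sigma>) ` pic m n D"
  \<comment> \<open>Both sides are shift classes, so one common element suffices.\<close>
  have "?C \<in> Dhat m n" by (rule Dhat_comp_permutes[OF s pic_in_Dhat[OF mn D]])
  then obtain y where y: "y \<in> Dset m n" "?C = shift_rel m n `` {y}"
    unfolding Dhat_def quotient_def by auto
  have "red m n D \<in> pic m n D"
    unfolding pic_def using equiv_class_self[OF equiv_shift_rel red_in_Dset[OF mn D]] .
  then have "red m n D \<circ> \<sigma> \<in> ?C" by blast
  then have "(y, red m n (D \<circ> \<sigma>)) \<in> shift_rel m n" using y red by simp
  then have "shift_rel m n `` {y} = shift_rel m n `` {red m n (D \<circ> \<sigma>)}"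
    by (rule equiv_class_eq[OF equiv_shift_rel])
  then show "pic m n (D \<circ> \<sigma>) = ?C"
    unfolding pic_def[of m n "D \<circ> \<sigma>"] y(2) by (rule sym)
qed

text \<open>The common criterion for the break divisors and the completed parking functions: each is
  a transversal of linear equivalence in \<open>Deg m n\<close>.\<close>

lemma bij_betw_pic:
  assumes mn: "m \<ge> 1" "n \<ge> 1" and sub: "B \<subseteq> Deg m n"
    and ex: "\<And>D. D \<in> Deg m n \<Longrightarrow> \<exists>D'\<in>B. \<exists>f. lin_equiv m n f D D'"
    and unique: "\<And>D D' f. D \<in> B \<Longrightarrow> D' \<in> B \<Longrightarrow> lin_equiv m n f D D' \<Longrightarrow> D = D'"
  shows "bij_betw (pic m n) B (Dhat m n)"
  unfolding bij_betw_def
proof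
  show "inj_on (pic m n) B"
    using unique pic_eq_iff[OF mn] sub by (meson inj_onI subsetD)
  show "pic m n ` B = Dhat m n"
  proof
    show "pic m n ` B \<subseteq> Dhat m n" using pic_in_Dhat[OF mn] sub by blast
    show "Dhat m n \<subseteq> pic m n ` B"
    proof
      fix C assume "C \<in> Dhat m n"
      then obtain D where D: "D \<in> Deg m n" "C = pic m n D" by (rule Dhat_eq_pic[OF mn])
      obtain D' f where "D' \<in> B" "lin_equiv m n f D D'" using ex[OF D(1)] by blast
      then show "C \<in> pic m n ` B" using D pic_eq_iff[OF mn D(1)] sub by blast
    qed
  qed
qed

text \<open>
  The maximum principle for the Laplacian: \<open>S\<close> and \<open>T\<close> are the sets where \<open>f\<close> attains its maximum
  and its minimum.
\<close>

lemma lin_equiv_neqE: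
  assumes f: "lin_equiv m n f D D'" and ne: "D \<noteq> D'"
    and ext: "D \<in> extensional {1..n}" "D' \<in> extensional {1..n}"
  obtains S T where "S \<noteq> {}" "T \<noteq> {}" "S \<subseteq> {1..n}" "T \<subseteq> {1..n}" "S \<inter> T = {}"
    "\<And>i. i \<in> S \<Longrightarrow> D' i \<ge> D i + int m * (int n - int (card S))"
    "\<And>i. i \<in> T \<Longrightarrow> D i \<ge> D' i + int m * (int n - int (card T))"
proof -
  have *: "\<exists>S. S \<noteq> {} \<and> S \<subseteq> {1..n} \<and> (\<forall>i\<in>S. f i = Max (f ` {1..n})) \<and>
      (\<forall>i\<in>S. D' i \<ge> D i + int m * (int n - int (card S)))"
    if f: "lin_equiv m n f D D'" and n: "n > 0" for f D D'
  proof -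
    define M where "M = Max (f ` {1..n})"
    define S where "S = {i \<in> {1..n}. f i = M}"
    have "M \<in> f ` {1..n}" unfolding M_def using n by (intro Max_in) auto
    then have S0: "S \<noteq> {}" by (auto simp: S_def)
    have le: "f j \<le> M" if "j \<in> {1..n}" for j using that by (simp add: M_def)
    have card: "int (card ({1..n} - S)) = int n - int (card S)"
    proof -
      have "S \<subseteq> {1..n}" by (auto simp: S_def)
      then have "card ({1..n} - S) = n - card S" "card S \<le> n"
        using card_mono[of "{1..n}" S] by (simp_all add: card_Diff_subset finite_subset)
      then show ?thesis by (simp add: of_nat_diff)
    qed
    have "D' i \<ge> D i + int m * (int n - int (card S))" if i: "i \<in> S" for i
    proof -
      have "D' i = D i + int m * (int n * M - (\<Sum>j\<in>{1..n}. f j))"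
        using f i by (auto simp: lin_equiv_def S_def algebra_simps)
      \<comment> \<open>On S, the Laplacian is m times the total drop of f below its maximum;
        integrality makes each vertex outside S contribute at least 1.\<close>
      also have "int n * M - (\<Sum>j\<in>{1..n}. f j) = (\<Sum>j\<in>{1..n}. M - f j)"
        by (simp add: sum_subtractf)
      also have "\<dots> = (\<Sum>j\<in>{1..n} - S. M - f j)"
        by (rule sum.mono_neutral_right) (auto simp: S_def)
      also have "D i + int m * \<dots> \<ge> D i + int m * (\<Sum>j\<in>{1..n} - S. 1)"
      proof (intro add_left_mono mult_left_mono sum_mono)
        fix j assume "j \<in> {1..n} - S"
        then show "1 \<le> M - f j" using le[of j] by (force simp: S_def)
      qed simp
      finally show ?thesis using card by simp
    qed
    moreover have "S \<subseteq> {1..n}" "\<forall>i\<in>S. f i = Max (f ` {1..n})"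
      by (auto simp: S_def M_def)
    ultimately show ?thesis using S0 by (intro exI[of _ S] conjI ballI) auto
  qed
  have n: "n > 0"
  proof (rule ccontr)
    assume "\<not> n > 0"
    then have "D = D'" using ext by (auto simp: extensional_def fun_eq_iff)
    then show False using ne by simp
  qed
  obtain S where S: "S \<noteq> {}" "S \<subseteq> {1..n}" "\<forall>i\<in>S. f i = Max (f ` {1..n})"
      "\<forall>i\<in>S. D' i \<ge> D i + int m * (int n - int (card S))"
    using *[OF f n] by blast
  obtain T where T: "T \<noteq> {}" "T \<subseteq> {1..n}" "\<forall>i\<in>T. - f i = Max ((\<lambda>i. - f i) ` {1..n})"
      "\<forall>i\<in>T. D i \<ge> D' i + int m * (int n - int (card T))"
    using *[OF lin_equiv_sym[OF f] n] by blast
  have "S \<inter> T = {}"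
  proof (rule ccontr)
    assume "S \<inter> T \<noteq> {}"
    then obtain k where k: "k \<in> S" "k \<in> T" by blast
    have "f i = f k" if "i \<in> {1..n}" for i
    proof -
      have "f i \<le> f k" using S(3) k that by simp
      moreover have "- f i \<le> - f k" using T(3) k that by simp
      ultimately show ?thesis by simp
    qed
    \<comment> \<open>Meeting sets of maxima and minima make f constant, and the Laplacian
      annihilates constants.\<close>
    then have "(\<Sum>j\<in>{1..n}. f j) = int n * f k" by simp
    then have "D i = D' i" for i
      using f \<open>\<And>i. i \<in> {1..n} \<Longrightarrow> f i = f k\<close> ext
      by (cases "i \<in> {1..n}") (auto simp: lin_equiv_def extensional_def)
    then show False using ne by blast
  qed
  then show thesis using S T by (intro that[of S T]) auto
qed

section \<open>Break divisors and parking functions as class representatives\<close>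

lemma int_choose_two: "2 * int (k choose 2) = int k * (int k - 1)"
proof (cases k)
  case (Suc j)
  have "even (k * (k - 1))" using Suc by simp
  then have "2 * (k choose 2) = k * (k - 1)" by (simp add: choose_two)
  then have "int (2 * (k choose 2)) = int (k * (k - 1))" by (rule arg_cong)
  then show ?thesis using Suc by (simp add: algebra_simps)
qed simp

lemma Break_subset_Deg: "Break m n \<subseteq> Deg m n"
  by (auto simp: Break_def Deg_def PiE_def)

lemma Break_lower_bound:
  assumes "D \<in> Break m n" "S \<noteq> {}" "S \<subseteq> {1..n}"
  shows "(\<Sum>v\<in>S. D v) \<ge> int m * int (card S choose 2) - int (card S) + 1"
proof -
  have "finite S" using assms(3) finite_subset by blast
  then show ?thesis using assms by (auto simp: Break_def card_multi_edges)
qed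

text \<open>On the set S where f is maximal, D' exceeds D by at least the number of edges leaving S.
  The break inequality for D' on the complement bounds the sum of D' over S from above, so the sum
  of D over S falls one short of its own break inequality.\<close>

lemma Break_unique:
  assumes D: "D \<in> Break m n" and D': "D' \<in> Break m n" and f: "lin_equiv m n f D D'"
  shows "D = D'"
proof (rule ccontr)
  assume ne: "D \<noteq> D'"
  have ext: "D \<in> extensional {1..n}" "D' \<in> extensional {1..n}"
    using D D' Break_subset_Deg by (auto simp: Deg_def)
  obtain S T where ST: "S \<noteq> {}" "T \<noteq> {}" "S \<subseteq> {1..n}" "T \<subseteq> {1..n}" "S \<inter> T = {}"
    and S: "\<And>i. i \<in> S \<Longrightarrow> D' i \<ge> D i + int m * (int n - int (card S))"
    using lin_equiv_neqE[OF f ne ext] by metis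
  define k l R where "k = card S" and "l = card ({1..n} - S)" and "R = {1..n} - S"
  have fin: "finite S" "finite R" using ST(3) by (auto simp: R_def intro: finite_subset)
  have l: "int n = int k + int l"
    using ST(3) fin(1) card_mono[OF _ ST(3)] by (simp add: k_def l_def card_Diff_subset)
  \<comment> \<open>The set T of minima lies in the complement of S; its nonemptiness makes the
    break inequality available there.\<close>
  have R: "R \<noteq> {}" "R \<subseteq> {1..n}" using ST by (auto simp: R_def)
  have "(\<Sum>i\<in>S. D i) + int k * (int m * int l) = (\<Sum>i\<in>S. D i + int m * (int n - int (card S)))"
    using l by (simp add: sum.distrib k_def)
  also have "\<dots> \<le> (\<Sum>i\<in>S. D' i)" by (rule sum_mono) (rule S)
  also have "\<dots> = genus m n - (\<Sum>i\<in>R. D' i)"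
  proof -
    have "(\<Sum>i\<in>{1..n}. D' i) = (\<Sum>i\<in>R. D' i) + (\<Sum>i\<in>S. D' i)"
      unfolding R_def by (rule sum.subset_diff[OF ST(3)]) simp
    then show ?thesis using D' by (simp add: Break_def)
  qed
  also have "\<dots> \<le> genus m n - (int m * int (l choose 2) - int l + 1)"
    using Break_lower_bound[OF D' R] by (simp add: l_def R_def)
  also have "genus m n = int m * (int (k choose 2) + int (l choose 2) + int k * int l) - int n + 1"
  proof -
    have "2 * int (n choose 2) = 2 * (int (k choose 2) + int (l choose 2) + int k * int l)"
      unfolding distrib_left int_choose_two l by (simp add: algebra_simps)
    then show ?thesis by (simp add: genus_def)
  qed
  finally have "(\<Sum>i\<in>S. D i) \<le> int m * int (k choose 2) - int k"
    using l by (simp add: algebra_simps)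
  moreover have "(\<Sum>i\<in>S. D i) \<ge> int m * int (k choose 2) - int k + 1"
    unfolding k_def by (rule Break_lower_bound[OF D ST(1,3)])
  ultimately show False by simp
qed

text \<open>
  Break divisors are the shortest vectors of their class: comparing \<open>D\<close> with the divisor obtained by
  firing the complement of \<open>S\<close> yields exactly the inequality for \<open>S\<close>.
\<close>

lemma Break_exists:
  assumes mn: "m \<ge> 1" "n \<ge> 1" and D0: "D0 \<in> Deg m n"
  shows "\<exists>D\<in>Break m n. \<exists>f. lin_equiv m n f D0 D"
proof -
  define Q where "Q D = (\<Sum>i\<in>{1..n}. (D i)\<^sup>2)" for D :: "nat \<Rightarrow> int"
  define P where "P D \<longleftrightarrow> D \<in> Deg m n \<and> (\<exists>f. lin_equiv m n f D0 D)" for D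
  have "lin_equiv m n (\<lambda>_. 0) D0 D0" by (simp add: lin_equiv_def)
  then have "P D0" using D0 by (auto simp: P_def)
  then obtain D where PD: "P D" and min: "\<And>D'. P D' \<Longrightarrow> nat (Q D) \<le> nat (Q D')"
    using ex_has_least_nat[of P D0 "\<lambda>D. nat (Q D)"] by blast
  have Q0: "Q D \<ge> 0" for D unfolding Q_def by (rule sum_nonneg) simp
  obtain f where D: "D \<in> Deg m n" and f: "lin_equiv m n f D0 D" using PD by (auto simp: P_def)
  define N where "N = int m * int n"
  have bound: "(\<Sum>v\<in>S. D v) \<ge> int m * int (card S choose 2) - int (card S) + 1"
    if S: "S \<noteq> {}" "S \<subseteq> {1..n}" for S
  proof -
    have finS: "finite S" using S(2) finite_subset by blast
    define k where "k = int (card S)"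
    have k: "k > 0" using S finS by (simp add: k_def card_gt_0_iff)
    define \<delta> where "\<delta> i = (if i \<in> S then 1 else 0 :: int)" for i
    have \<delta>: "(\<Sum>i\<in>{1..n}. c i * \<delta> i) = (\<Sum>i\<in>S. c i)" for c :: "nat \<Rightarrow> int"
    proof -
      have "(\<Sum>i\<in>{1..n}. c i * \<delta> i) = (\<Sum>i\<in>{1..n}. if i \<in> S then c i else 0)"
        by (rule sum.cong) (auto simp: \<delta>_def)
      also have "\<dots> = (\<Sum>i\<in>{1..n} \<inter> S. c i)" by (simp add: sum.inter_restrict)
      also have "{1..n} \<inter> S = S" using S(2) by blast
      finally show ?thesis .
    qed
    have \<delta>1: "(\<Sum>i\<in>{1..n}. \<delta> i) = k" using \<delta>[of "\<lambda>_. 1"] by (simp add: k_def)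
    have \<delta>2: "\<delta> i * \<delta> i = \<delta> i" for i by (simp add: \<delta>_def)
    \<comment> \<open>Firing the complement of S: each vertex of S gains m (n - k), every other
      vertex loses m k.\<close>
    define D' where "D' = (\<lambda>i\<in>{1..n}. D i + (N * \<delta> i - int m * k))"
    have DD': "lin_equiv m n \<delta> D D'"
      unfolding lin_equiv_def \<delta>1 D'_def by (simp add: N_def)
    then have "(\<Sum>i\<in>{1..n}. D' i) = genus m n" using D lin_equiv_sum by (simp add: Deg_def)
    then have "P D'" using lin_equiv_trans[OF f DD'] by (auto simp: P_def Deg_def D'_def)
    then have "Q D \<le> Q D'" using min Q0 by (simp add: nat_le_eq_zle)
    also have "Q D' = (\<Sum>i\<in>{1..n}. (D i + (N * \<delta> i - int m * k))\<^sup>2)"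
      unfolding Q_def by (rule sum.cong) (simp_all add: D'_def)
    also have "\<dots> = (\<Sum>i\<in>{1..n}. (D i)\<^sup>2 + (2 * N * (D i * \<delta> i) - 2 * (int m * k) * D i +
        (N * N - 2 * N * (int m * k)) * \<delta> i + (int m * k)\<^sup>2))"
    proof (rule sum.cong[OF refl])
      fix i
      have "(D i + (N * \<delta> i - int m * k))\<^sup>2 = (D i)\<^sup>2 + (2 * N * (D i * \<delta> i) - 2 * (int m * k) * D i +
        (N * N) * (\<delta> i * \<delta> i) - (2 * N * (int m * k)) * \<delta> i + (int m * k)\<^sup>2)"
        by (simp add: power2_eq_square algebra_simps)
      then show "(D i + (N * \<delta> i - int m * k))\<^sup>2 = (D i)\<^sup>2 + (2 * N * (D i * \<delta> i) -
          2 * (int m * k) * D i + (N * N - 2 * N * (int m * k)) * \<delta> i + (int m * k)\<^sup>2)"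
        unfolding \<delta>2 by (simp add: algebra_simps)
    qed
    also have "\<dots> = Q D + (2 * N * (\<Sum>i\<in>S. D i) - 2 * (int m * k) * genus m n +
        (N * N - 2 * N * (int m * k)) * k + int n * (int m * k)\<^sup>2)"
      using D \<delta>[of D] \<delta>1
      by (simp add: sum.distrib sum_subtractf Q_def Deg_def flip: sum_distrib_left)
    finally have 1: "0 \<le> 2 * N * (\<Sum>i\<in>S. D i) - 2 * (int m * k) * genus m n +
        (N * N - 2 * N * (int m * k)) * k + int n * (int m * k)\<^sup>2" by simp
    define x where "x = (\<Sum>i\<in>S. D i)"
    have g: "2 * genus m n = int m * (int n * (int n - 1)) - 2 * int n + 2"
      unfolding genus_def int_choose_two[of n, symmetric] by (simp add: algebra_simps)
    have "2 * N * x - 2 * (int m * k) * genus m n +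
        (N * N - 2 * N * (int m * k)) * k + int n * (int m * k)\<^sup>2 =
        int m * (int n * (2 * x) - k * (2 * genus m n) +
          int m * int n * int n * k - int m * int n * k * k)"
      by (simp add: N_def power2_eq_square algebra_simps)
    also have "\<dots> = int m * (int n * (2 * x - (int m * (k * (k - 1)) - 2 * k)) - 2 * k)"
      unfolding g by (simp add: algebra_simps)
    finally have "0 \<le> int m * (int n * (2 * x - (int m * (k * (k - 1)) - 2 * k)) - 2 * k)"
      using 1 by (simp add: x_def)
    \<comment> \<open>The term 2 k stems from the constant 1 in the genus. It makes the next
      inequality strict, and by parity this yields the + 1 in the break inequality.\<close>
    then have "2 * k \<le> int n * (2 * x - (int m * (k * (k - 1)) - 2 * k))"
      using mn by (simp add: zero_le_mult_iff)
    then have "0 < int n * (2 * x - (int m * (k * (k - 1)) - 2 * k))" using k by linarith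
    then have "0 < 2 * x - (int m * (k * (k - 1)) - 2 * k)" using mn by (simp add: zero_less_mult_iff)
    moreover have "k * (k - 1) = 2 * int (card S choose 2)" by (simp add: int_choose_two k_def)
    ultimately have "0 < 2 * x - (int m * (2 * int (card S choose 2)) - 2 * k)" by simp
    then show ?thesis by (simp add: x_def k_def)
  qed
  \<comment> \<open>For a singleton, the lower bound is 0 - 1 + 1 = 0.\<close>
  have "D i \<ge> 0" if "i \<in> {1..n}" for i using bound[of "{i}"] that by (simp add: numeral_2_eq_2)
  then have "D \<in> {1..n} \<rightarrow>\<^sub>E {0..}" using D by (auto simp: Deg_def PiE_def)
  moreover have "int (card (multi_edges m S)) - int (card S) + 1 \<le> (\<Sum>v\<in>S. D v)"
    if "S \<noteq> {}" "S \<subseteq> {1..n}" for S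
    using bound[OF that] that(2) by (simp add: card_multi_edges finite_subset)
  ultimately have "D \<in> Break m n" using D by (auto simp: Break_def Deg_def)
  then show ?thesis using f by blast
qed

lemma bij_betw_pic_Break:
  assumes "m \<ge> 1" "n \<ge> 1"
  shows "bij_betw (pic m n) (Break m n) (Dhat m n)"
  using assms Break_subset_Deg Break_exists Break_unique by (intro bij_betw_pic) blast+

section \<open>Parking functions as divisors reduced at the last vertex\<close>

lemma card_ge_sort:
  "card {j \<in> {1..n-1}. (c::int) \<le> d j} = card {i. i < n - 1 \<and> c \<le> sort (map d [1..<n]) ! i}"
proof -
  have "card {i. i < n - 1 \<and> c \<le> sort (map d [1..<n]) ! i} =
      length (filter ((\<le>) c) (sort (map d [1..<n])))"
    by (simp add: length_filter_conv_card)
  also have "\<dots> = length (filter ((\<le>) c) (map d [1..<n]))"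
    by (metis mset_filter mset_sort size_mset)
  also have "\<dots> = length (filter (\<lambda>j. c \<le> d j) [1..<n])"
    by (simp add: filter_map comp_def)
  also have "\<dots> = card (set (filter (\<lambda>j. c \<le> d j) [1..<n]))"
    by (rule distinct_card[symmetric]) simp
  also have "set (filter (\<lambda>j. c \<le> d j) [1..<n]) = {j \<in> {1..n-1}. c \<le> d j}" by auto
  finally show ?thesis by simp
qed

text \<open>The subset condition says that no nonempty set S avoiding the vertex n can be fired
  without debt in S, as m (n - card S) is the number of edges from a vertex of S to its complement.
  The link with sorting is a count: the i-th smallest entry is below m i iff fewer than n - i
  entries reach m i, and n - i entries that do form a violating S.\<close>

lemma Park_iff:
  "d \<in> Park m n \<longleftrightarrow> d \<in> {1..n-1} \<rightarrow>\<^sub>E {0..} \<and>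
     (\<forall>S. S \<noteq> {} \<and> S \<subseteq> {1..n-1} \<longrightarrow> (\<exists>i\<in>S. d i < int m * (int n - int (card S))))"
proof -
  define xs where "xs = sort (map d [1..<n])"
  have len: "length xs = n - 1" by (simp add: xs_def)
  have sorted: "sorted xs" by (simp add: xs_def)
  have 1: "xs ! (i - 1) \<le> int m * int i - 1 \<longleftrightarrow> card {j \<in> {1..n-1}. int m * int i \<le> d j} < n - i"
    if i: "i \<in> {1..n-1}" for i
  proof
    assume le: "xs ! (i - 1) \<le> int m * int i - 1"
    have "{j. j < n - 1 \<and> int m * int i \<le> xs ! j} \<subseteq> {i..<n-1}"
    proof
      fix j assume j: "j \<in> {j. j < n - 1 \<and> int m * int i \<le> xs ! j}"
      have "\<not> j \<le> i - 1"
      proof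
        assume "j \<le> i - 1"
        then have "xs ! j \<le> xs ! (i - 1)" using sorted_nth_mono[OF sorted] i len by auto
        then show False using j le by auto
      qed
      then show "j \<in> {i..<n-1}" using j by auto
    qed
    then have "card {j. j < n - 1 \<and> int m * int i \<le> xs ! j} \<le> card {i..<n-1}"
      by (intro card_mono) auto
    then show "card {j \<in> {1..n-1}. int m * int i \<le> d j} < n - i"
      unfolding card_ge_sort xs_def[symmetric] using i by auto
  next
    assume less: "card {j \<in> {1..n-1}. int m * int i \<le> d j} < n - i"
    show "xs ! (i - 1) \<le> int m * int i - 1"
    proof (rule ccontr)
      assume "\<not> xs ! (i - 1) \<le> int m * int i - 1"
      then have gt: "int m * int i \<le> xs ! (i - 1)" by simp
      have "{i-1..<n-1} \<subseteq> {j. j < n - 1 \<and> int m * int i \<le> xs ! j}"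
      proof
        fix j assume j: "j \<in> {i-1..<n-1}"
        then have "xs ! (i - 1) \<le> xs ! j" using sorted_nth_mono[OF sorted] i len by auto
        then show "j \<in> {j. j < n - 1 \<and> int m * int i \<le> xs ! j}" using j gt by auto
      qed
      then have "card {i-1..<n-1} \<le> card {j. j < n - 1 \<and> int m * int i \<le> xs ! j}"
        by (intro card_mono) auto
      then show False using less i unfolding card_ge_sort xs_def[symmetric] by simp
    qed
  qed
  have 2: "(\<forall>i\<in>{1..n-1}. card {j \<in> {1..n-1}. int m * int i \<le> d j} < n - i) \<longleftrightarrow>
     (\<forall>S. S \<noteq> {} \<and> S \<subseteq> {1..n-1} \<longrightarrow> (\<exists>i\<in>S. d i < int m * (int n - int (card S))))"
    (is "?L = ?R")
  proof
    assume L: ?L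
    show ?R
    proof (intro allI impI, rule ccontr)
      fix S assume S: "S \<noteq> {} \<and> S \<subseteq> {1..n-1}"
        and *: "\<not> (\<exists>i\<in>S. d i < int m * (int n - int (card S)))"
      have "finite S" using S finite_subset by blast
      then have c: "card S > 0" "card S \<le> n - 1"
        using S card_mono[of "{1..n-1}" S] by (auto simp: card_gt_0_iff)
      define i where "i = n - card S"
      have i: "i \<in> {1..n-1}" "int i = int n - int (card S)" using c by (auto simp: i_def)
      have "S \<subseteq> {j \<in> {1..n-1}. int m * int i \<le> d j}" using S * i(2) by (auto simp: not_less)
      then have "card S \<le> card {j \<in> {1..n-1}. int m * int i \<le> d j}" by (intro card_mono) auto
      moreover have "card {j \<in> {1..n-1}. int m * int i \<le> d j} < n - i" using L i(1) by blast
      moreover have "n - i = card S" using c by (simp add: i_def)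
      ultimately show False by linarith
    qed
  next
    assume R: ?R
    show ?L
    proof (rule ballI, rule ccontr)
      fix i assume i: "i \<in> {1..n-1}" and "\<not> card {j \<in> {1..n-1}. int m * int i \<le> d j} < n - i"
      then have "n - i \<le> card {j \<in> {1..n-1}. int m * int i \<le> d j}" by simp
      then obtain S where S: "S \<subseteq> {j \<in> {1..n-1}. int m * int i \<le> d j}" "card S = n - i"
        by (rule obtain_subset_with_card_n) auto
      then have "S \<noteq> {}" using i by auto
      then obtain j where "j \<in> S" "d j < int m * (int n - int (card S))" using R S(1) by blast
      moreover have "int n - int (card S) = int i" using S(2) i by auto
      ultimately show False using S(1) by auto
    qed
  qed
  show ?thesis
    unfolding Park_def mem_Collect_eq 2[symmetric] xs_def[symmetric] using 1 by blast
qed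

text \<open>
  A parking function is completed to a divisor of degree \<open>g\<close>; the completions are the divisors that
  are reduced at the vertex \<open>n\<close>.
\<close>

definition complete_div :: "nat \<Rightarrow> nat \<Rightarrow> (nat \<Rightarrow> int) \<Rightarrow> (nat \<Rightarrow> int)" where
  "complete_div m n d = (\<lambda>i\<in>{1..n}. if i = n then genus m n - (\<Sum>j\<in>{1..n-1}. d j) else d i)"

lemma sum_split_last:
  "n \<ge> 1 \<Longrightarrow> (\<Sum>i\<in>{1..n}. f i) = (\<Sum>i\<in>{1..n-1}. f i) + f (n :: nat)"
  by (cases n) auto

lemma complete_in_Deg:
  assumes "n \<ge> 1"
  shows "complete_div m n d \<in> Deg m n"
proof -
  have "(\<Sum>i\<in>{1..n-1}. complete_div m n d i) = (\<Sum>i\<in>{1..n-1}. d i)"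
    by (rule sum.cong) (auto simp: complete_div_def)
  then have "(\<Sum>i\<in>{1..n}. complete_div m n d i) = genus m n"
    unfolding sum_split_last[OF assms] using assms by (simp add: complete_div_def)
  then show ?thesis by (simp add: Deg_def complete_div_def)
qed

lemma complete_restrict:
  assumes "n \<ge> 1" "D \<in> Deg m n"
  shows "complete_div m n (restrict D {1..n-1}) = D"
proof
  fix i
  show "complete_div m n (restrict D {1..n-1}) i = D i"
    using assms sum_split_last[OF assms(1), of D]
    by (auto simp: complete_div_def Deg_def extensional_def)
qed

text \<open>The sets of maxima and minima of f are disjoint, so one of them avoids n. On that set
  one parking function exceeds the other, which is nonnegative, by the outdegree everywhere,
  contradicting \<open>Park_iff\<close>.\<close>

lemma complete_unique:
  assumes n: "n \<ge> 1" and d: "d \<in> Park m n" and d': "d' \<in> Park m n"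
    and f: "lin_equiv m n f (complete_div m n d) (complete_div m n d')"
  shows "complete_div m n d = complete_div m n d'"
proof (rule ccontr)
  let ?D = "complete_div m n d" and ?D' = "complete_div m n d'"
  assume ne: "?D \<noteq> ?D'"
  have ext: "?D \<in> extensional {1..n}" "?D' \<in> extensional {1..n}" by (simp_all add: complete_div_def)
  have no: False if S: "S \<noteq> {}" "S \<subseteq> {1..n}" "n \<notin> S" "b \<in> Park m n" "a \<in> Park m n"
    and ge: "\<And>i. i \<in> S \<Longrightarrow> complete_div m n b i \<ge> complete_div m n a i + int m * (int n - int (card S))"
    for S a b
  proof -
    have S': "S \<subseteq> {1..n-1}"
    proof
      fix i assume "i \<in> S"
      then have "1 \<le> i" "i \<le> n" "i \<noteq> n" using S by auto
      then show "i \<in> {1..n-1}" by auto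
    qed
    then obtain i where i: "i \<in> S" "b i < int m * (int n - int (card S))"
      using S unfolding Park_iff by blast
    have in1: "i \<in> {1..n-1}" using i S' by blast
    then have "a i \<ge> 0" using S(5) unfolding Park_iff by (auto simp: PiE_def Pi_def)
    moreover have "complete_div m n b i = b i" "complete_div m n a i = a i"
      using in1 by (auto simp: complete_div_def)
    ultimately show False using ge[OF i(1)] i(2) by simp
  qed
  obtain S T where ST: "S \<noteq> {}" "T \<noteq> {}" "S \<subseteq> {1..n}" "T \<subseteq> {1..n}" "S \<inter> T = {}"
    and S: "\<And>i. i \<in> S \<Longrightarrow> ?D' i \<ge> ?D i + int m * (int n - int (card S))"
    and T: "\<And>i. i \<in> T \<Longrightarrow> ?D i \<ge> ?D' i + int m * (int n - int (card T))"
    by (rule lin_equiv_neqE[OF f ne ext], rule that)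
  show False
  proof (cases "n \<in> S")
    case True
    then have "n \<notin> T" using ST(5) by blast
    then show False using no[OF ST(2,4) _ d d'] T by blast
  next
    case False
    then show False using no[OF ST(1,3) _ d' d] S by blast
  qed
qed

text \<open>Among the equivalent divisors that are nonnegative away from n, one minimises the total
  away from n. If a set S violated \<open>Park_iff\<close>, firing S would preserve nonnegativity
  away from n and move m chips from each vertex of S to n, contradicting minimality.\<close>

lemma complete_exists:
  assumes mn: "m \<ge> 1" "n \<ge> 1" and D0: "D0 \<in> Deg m n"
  shows "\<exists>d\<in>Park m n. \<exists>f. lin_equiv m n f D0 (complete_div m n d)"
proof -
  define Q where "Q D = (\<Sum>i\<in>{1..n-1}. D i)" for D :: "nat \<Rightarrow> int"
  define P where "P D \<longleftrightarrow> D \<in> Deg m n \<and> (\<exists>f. lin_equiv m n f D0 D) \<and> (\<forall>i\<in>{1..n-1}. D i \<ge> 0)" for D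
  have deg: "(\<lambda>i\<in>{1..n}. D i + int (m * n) * f i - int m * (\<Sum>j\<in>{1..n}. f j)) \<in> Deg m n \<and>
      lin_equiv m n f D (\<lambda>i\<in>{1..n}. D i + int (m * n) * f i - int m * (\<Sum>j\<in>{1..n}. f j))"
    (is "?E \<in> _ \<and> _") if "D \<in> Deg m n" for D f
  proof
    show le: "lin_equiv m n f D ?E" by (simp add: lin_equiv_def)
    show "?E \<in> Deg m n" using lin_equiv_sum[OF le] that by (simp add: Deg_def)
  qed
  \<comment> \<open>A starting point: f0 sums to zero, so its Laplacian adds m n \<bar>D0 i\<bar> at
    each i < n, enough to cancel any debt there.\<close>
  define f0 where "f0 i = (if i = n then - (\<Sum>j\<in>{1..n-1}. \<bar>D0 j\<bar>) else \<bar>D0 i\<bar>)" for i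
  have "(\<Sum>j\<in>{1..n-1}. f0 j) = (\<Sum>j\<in>{1..n-1}. \<bar>D0 j\<bar>)" by (rule sum.cong) (auto simp: f0_def)
  then have f0: "(\<Sum>j\<in>{1..n}. f0 j) = 0"
    unfolding sum_split_last[OF mn(2)] by (simp add: f0_def)
  define D1 where "D1 = (\<lambda>i\<in>{1..n}. D0 i + int (m * n) * f0 i - int m * (\<Sum>j\<in>{1..n}. f0 j))"
  have "D1 i \<ge> 0" if "i \<in> {1..n-1}" for i
  proof -
    have "int (m * n) \<ge> 1" using mn by (simp del: of_nat_mult)
    then have "int (m * n) * \<bar>D0 i\<bar> \<ge> 1 * \<bar>D0 i\<bar>" by (intro mult_right_mono) auto
    moreover have "D1 i = D0 i + int (m * n) * \<bar>D0 i\<bar>"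
      unfolding D1_def f0 using that by (auto simp: f0_def)
    ultimately show ?thesis by linarith
  qed
  then have "P D1" using deg[OF D0, of f0] unfolding P_def D1_def by blast
  then obtain D where PD: "P D" and min: "\<And>D'. P D' \<Longrightarrow> nat (Q D) \<le> nat (Q D')"
    using ex_has_least_nat[of P D1 "\<lambda>D. nat (Q D)"] by blast
  have Q0: "Q D \<ge> 0" if "P D" for D
    using that unfolding Q_def P_def by (intro sum_nonneg) auto
  obtain f where D: "D \<in> Deg m n" and f: "lin_equiv m n f D0 D" using PD by (auto simp: P_def)
  have "\<exists>i\<in>S. D i < int m * (int n - int (card S))" if S: "S \<noteq> {}" "S \<subseteq> {1..n-1}" for S
  proof (rule ccontr)
    assume "\<not> (\<exists>i\<in>S. D i < int m * (int n - int (card S)))"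
    then have ge: "\<And>i. i \<in> S \<Longrightarrow> D i \<ge> int m * (int n - int (card S))" by force
    have finS: "finite S" using S(2) finite_subset by blast
    have c: "card S > 0" using S finS by (simp add: card_gt_0_iff)
    define \<delta> where "\<delta> i = (if i \<in> S then - 1 else 0 :: int)" for i
    have "{1..n-1} \<subseteq> {1..n}" by auto
    then have "S \<subseteq> {1..n}" using S(2) by (rule order.trans[rotated])
    then have "{1..n} \<inter> S = S" by blast
    then have \<delta>: "(\<Sum>i\<in>{1..n}. \<delta> i) = - int (card S)"
      unfolding \<delta>_def by (simp flip: sum.inter_restrict)
    define D' where "D' = (\<lambda>i\<in>{1..n}. D i + int (m * n) * \<delta> i - int m * (\<Sum>j\<in>{1..n}. \<delta> j))"
    have D': "D' \<in> Deg m n" "lin_equiv m n \<delta> D D'" using deg[OF D, of \<delta>] by (simp_all add: D'_def)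
    have "D' i \<ge> 0" if i: "i \<in> {1..n-1}" for i
    proof (cases "i \<in> S")
      case True
      then show ?thesis using ge[OF True] i unfolding D'_def \<delta> by (auto simp: \<delta>_def algebra_simps)
    next
      case False
      then show ?thesis using i PD unfolding D'_def \<delta> P_def by (auto simp: \<delta>_def)
    qed
    then have PD': "P D'" using D' lin_equiv_trans[OF f D'(2)] by (auto simp: P_def)
    have "n \<notin> S" using S(2) mn by auto
    then have "D' n = D n + int m * int (card S)"
      using mn unfolding D'_def \<delta> by (simp add: \<delta>_def)
    then have "D' n > D n" using c mn by simp
    moreover have "Q D + D n = genus m n" "Q D' + D' n = genus m n"
      using D D'(1) sum_split_last[OF mn(2), of D] sum_split_last[OF mn(2), of D']
      by (simp_all add: Deg_def Q_def)
    ultimately show False using min[OF PD'] Q0[OF PD] Q0[OF PD'] by simp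
  qed
  then have "restrict D {1..n-1} \<in> Park m n"
    unfolding Park_iff using PD by (auto simp: P_def subset_iff)
  then show ?thesis using f complete_restrict[OF mn(2) D] by metis
qed

lemma bij_betw_pic_complete:
  assumes mn: "m \<ge> 1" "n \<ge> 1"
  shows "bij_betw (pic m n \<circ> complete_div m n) (Park m n) (Dhat m n)"
proof (rule bij_betw_trans)
  show "bij_betw (complete_div m n) (Park m n) (complete_div m n ` Park m n)"
    unfolding bij_betw_def
  proof
    show "inj_on (complete_div m n) (Park m n)"
    proof (rule inj_onI)
      fix d d' assume d: "d \<in> Park m n" "d' \<in> Park m n"
        and eq: "complete_div m n d = complete_div m n d'"
      show "d = d'"
      proof
        fix i
        show "d i = d' i"
        proof (cases "i \<in> {1..n-1}")
          case True
          then have "i \<noteq> n" "i \<in> {1..n}" by auto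
          then show ?thesis using fun_cong[OF eq, of i] by (simp add: complete_div_def)
        next
          case False
          then show ?thesis using d by (auto simp: Park_def PiE_def extensional_def)
        qed
      qed
    qed
  qed simp
  show "bij_betw (pic m n) (complete_div m n ` Park m n) (Dhat m n)"
    by (rule bij_betw_pic[OF mn])
      (use complete_in_Deg[OF mn(2)] complete_exists[OF mn] complete_unique[OF mn(2)] in blast)+
qed

lemma complete_comp_permutes:
  assumes "\<sigma> permutes {1..n-1}"
  shows "complete_div m n (d \<circ> \<sigma>) = complete_div m n d \<circ> \<sigma>"
proof (cases "n = 0")
  case False
  have fixed: "\<sigma> i = i" if "i \<notin> {1..n-1}" for i using assms that by (rule permutes_not_in)
  have sum: "(\<Sum>j\<in>{1..n-1}. d (\<sigma> j)) = (\<Sum>j\<in>{1..n-1}. d j)"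
    using sum_comp_permutes[OF assms, of d "{1..n-1}"] permutes_image[OF assms] by simp
  show ?thesis
  proof
    fix i
    show "complete_div m n (d \<circ> \<sigma>) i = (complete_div m n d \<circ> \<sigma>) i"
    proof (cases "i \<in> {1..n-1}")
      case True
      then have "\<sigma> i \<in> {1..n-1}" using permutes_in_image[OF assms] by blast
      then have "i \<in> {1..n}" "i \<noteq> n" "\<sigma> i \<in> {1..n}" "\<sigma> i \<noteq> n" using True by auto
      then show ?thesis by (simp add: complete_div_def)
    next
      case False
      then show ?thesis using sum by (simp add: complete_div_def fixed)
    qed
  qed
next
  case True
  then show ?thesis using assms by (auto simp: complete_div_def)
qed

section \<open>Equivariance of the class maps\<close>

lemma reps_isomorphic_Break_Dhat:
  assumes mn: "m \<ge> 1" "n \<ge> 1"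
  shows "reps_isomorphic (sym_group n)
       (free_space (Break m n))
       (perm_rep (sym_group n) (Break m n) (coord_action (Break m n)))
       (free_space (Dhat m n))
       (perm_rep (sym_group n) (Dhat m n) (coord_action_classes (Dhat m n)))"
proof (rule reps_isomorphic_perm_repI[OF bij_betw_pic_Break[OF mn]])
  fix \<sigma> D assume s: "\<sigma> \<in> carrier (sym_group n)" and D: "D \<in> Break m n"
  have s': "inv\<^bsub>sym_group n\<^esub> \<sigma> \<in> carrier (sym_group n)"
    using s sym_group_is_group by (rule group.inv_closed[rotated])
  show "coord_action (Break m n) (inv\<^bsub>sym_group n\<^esub> \<sigma>) D \<in> Break m n"
    by (rule group_action.element_image[OF group_action_Break s' D refl])
  have p: "\<sigma> permutes {1..n}" using s by (simp add: sym_group_carrier)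
  have "D \<in> Deg m n" using D Break_subset_Deg by blast
  then show "pic m n (coord_action (Break m n) (inv\<^bsub>sym_group n\<^esub> \<sigma>) D) =
      coord_action_classes (Dhat m n) (inv\<^bsub>sym_group n\<^esub> \<sigma>) (pic m n D)"
    using s D p pic_comp_permutes[OF mn _ p] pic_in_Dhat[OF mn]
    by (simp add: coord_action_def coord_action_classes_def permutes_inv_inv)
qed

lemma card_orbits_Break:
  assumes mn: "m \<ge> 1" "n \<ge> 1"
  shows "card (orbits (sym_group n) (Break m n) (coord_action (Break m n))) =
    card (orbits (sym_group n) (Dhat m n) (coord_action_classes (Dhat m n)))"
proof (rule card_orbits_eqI[OF bij_betw_pic_Break[OF mn]])
  fix \<sigma> D assume s: "\<sigma> \<in> carrier (sym_group n)" and D: "D \<in> Break m n"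
  show "coord_action (Break m n) \<sigma> D \<in> Break m n"
    by (rule group_action.element_image[OF group_action_Break s D refl])
  have p: "inv' \<sigma> permutes {1..n}" using s by (simp add: sym_group_carrier permutes_inv)
  have "D \<in> Deg m n" using D Break_subset_Deg by blast
  then show "pic m n (coord_action (Break m n) \<sigma> D) =
      coord_action_classes (Dhat m n) \<sigma> (pic m n D)"
    using D pic_comp_permutes[OF mn _ p] pic_in_Dhat[OF mn]
    by (simp add: coord_action_def coord_action_classes_def)
qed

text \<open>\<beta> sends a break divisor to the parking function in the same class. A permutation
  fixing n commutes with completion, so equivariance of \<beta> is checked on classes, where
  \<gamma> is injective.\<close>

lemma reps_isomorphic_Break_Park:
  assumes mn: "m \<ge> 1" "n \<ge> 1"
  shows "reps_isomorphic ((sym_group n)\<lparr>carrier := {\<sigma> \<in> carrier (sym_group n). \<sigma> n = n}\<rparr>)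
       (free_space (Break m n))
       (perm_rep (sym_group n) (Break m n) (coord_action (Break m n)))
       (free_space (Park m n))
       (perm_rep (sym_group (n - 1)) (Park m n) (coord_action (Park m n)))"
proof -
  define \<gamma> where "\<gamma> = pic m n \<circ> complete_div m n"
  have \<gamma>: "bij_betw \<gamma> (Park m n) (Dhat m n)" unfolding \<gamma>_def by (rule bij_betw_pic_complete[OF mn])
  define \<beta> where "\<beta> = inv_into (Park m n) \<gamma> \<circ> pic m n"
  have \<beta>: "bij_betw \<beta> (Break m n) (Park m n)"
    unfolding \<beta>_def by (rule bij_betw_trans[OF bij_betw_pic_Break[OF mn] bij_betw_inv_into[OF \<gamma>]])
  show ?thesis
  proof (rule reps_isomorphic_perm_repI[OF \<beta>])
    fix \<sigma> D
    assume "\<sigma> \<in> carrier ((sym_group n)\<lparr>carrier := {\<sigma> \<in> carrier (sym_group n). \<sigma> n = n}\<rparr>)"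
      and D: "D \<in> Break m n"
    then have s: "\<sigma> \<in> carrier (sym_group n)" and s1: "\<sigma> \<in> carrier (sym_group (n - 1))"
      using carrier_sym_group_pred[OF mn(2)] by auto
    have s': "inv\<^bsub>sym_group n\<^esub> \<sigma> \<in> carrier (sym_group n)"
      using s sym_group_is_group by (rule group.inv_closed[rotated])
    show cl: "coord_action (Break m n) (inv\<^bsub>sym_group n\<^esub> \<sigma>) D \<in> Break m n"
      by (rule group_action.element_image[OF group_action_Break s' D refl])
    have p: "\<sigma> permutes {1..n}" using s by (simp add: sym_group_carrier)
    have p1: "\<sigma> permutes {1..n-1}" using s1 by (simp only: sym_group_carrier mem_Collect_eq)
    have act: "coord_action (Break m n) (inv\<^bsub>sym_group n\<^esub> \<sigma>) D = D \<circ> \<sigma>"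
      using s D p by (simp add: coord_action_def permutes_inv_inv)
    define d where "d = \<beta> D"
    have d: "d \<in> Park m n" using \<beta> D unfolding d_def by (auto simp: bij_betw_def)
    have act1: "coord_action (Park m n) (inv\<^bsub>sym_group (n-1)\<^esub> \<sigma>) d = d \<circ> \<sigma>"
      using s1 d p1 by (simp add: coord_action_def permutes_inv_inv)
    have s1': "inv\<^bsub>sym_group (n-1)\<^esub> \<sigma> \<in> carrier (sym_group (n-1))"
      using s1 sym_group_is_group by (rule group.inv_closed[rotated])
    have d\<sigma>: "d \<circ> \<sigma> \<in> Park m n"
      unfolding act1[symmetric] by (rule group_action.element_image[OF group_action_Park s1' d refl])
    have DD: "D \<in> Deg m n" using D Break_subset_Deg by blast
    have "\<gamma> d = pic m n D"
      unfolding d_def \<beta>_def comp_apply using \<gamma> pic_in_Dhat[OF mn DD]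
      by (metis bij_betw_inv_into_right)
    then have "\<gamma> (d \<circ> \<sigma>) = pic m n (D \<circ> \<sigma>)"
      unfolding \<gamma>_def comp_apply complete_comp_permutes[OF p1]
        pic_comp_permutes(2)[OF mn DD p] pic_comp_permutes(2)[OF mn complete_in_Deg[OF mn(2)] p]
      by simp
    then have "\<beta> (D \<circ> \<sigma>) = inv_into (Park m n) \<gamma> (\<gamma> (d \<circ> \<sigma>))"
      by (simp only: \<beta>_def comp_apply[of "inv_into (Park m n) \<gamma>"])
    also have "\<dots> = d \<circ> \<sigma>"
      by (rule inv_into_f_f[OF bij_betw_imp_inj_on[OF \<gamma>] d\<sigma>])
    finally show "\<beta> (coord_action (Break m n) (inv\<^bsub>sym_group n\<^esub> \<sigma>) D) =
        coord_action (Park m n) (inv\<^bsub>sym_group (n-1)\<^esub> \<sigma>) (\<beta> D)"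
      unfolding act act1[unfolded d_def] d_def .
  qed
qed

section \<open>Counting orbits\<close>

text \<open>Stated through the order of z, so that later arguments need only divisibility and no
  exponentials.\<close>

definition primitive_root :: "nat \<Rightarrow> complex \<Rightarrow> bool" where
  "primitive_root n z \<longleftrightarrow> n > 0 \<and> (\<forall>k. z ^ k = 1 \<longleftrightarrow> n dvd k)"

lemma primitive_root_exists:
  assumes "n > 0"
  obtains z where "primitive_root n z"
proof
  define z where "z = exp (2 * of_real pi * \<i> / of_nat n)"
  have "z ^ k = exp (2 * of_real pi * \<i> * of_nat k / of_nat n)" for k
    by (simp add: z_def mult_ac flip: exp_of_nat_mult)
  then show "primitive_root n z"
    unfolding primitive_root_def using assms complex_root_unity_eq_1[of n] by simp
qed

lemma primitive_root_power:
  assumes "primitive_root n z"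
  shows "primitive_root (n div gcd j n) (z ^ j)"
proof -
  have n: "n > 0" and z: "\<And>k. z ^ k = 1 \<longleftrightarrow> n dvd k"
    using assms by (auto simp: primitive_root_def)
  define g where "g = gcd j n"
  have g: "g > 0" "g dvd n" "g dvd j" using n by (simp_all add: g_def)
  have cop: "coprime (n div g) (j div g)"
    unfolding g_def using n by (metis coprime_commute div_gcd_coprime less_irrefl)
  have "(z ^ j) ^ k = 1 \<longleftrightarrow> n div g dvd k" for k
  proof -
    have "(z ^ j) ^ k = 1 \<longleftrightarrow> n dvd j * k" by (simp add: z flip: power_mult)
    also have "\<dots> \<longleftrightarrow> g * (n div g) dvd g * ((j div g) * k)"
      using g by (simp add: mult.assoc[symmetric])
    also have "\<dots> \<longleftrightarrow> n div g dvd (j div g) * k"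
      using g(1) by (rule nat_mult_dvd_cancel1)
    also have "\<dots> \<longleftrightarrow> n div g dvd k" using cop by (simp add: coprime_dvd_mult_right_iff)
    finally show ?thesis .
  qed
  moreover have "n div g > 0" using g n by (metis dvd_div_eq_0_iff gr0I less_irrefl)
  ultimately show ?thesis by (simp add: primitive_root_def g_def)
qed

lemma sum_primitive_root_powers:
  assumes "primitive_root n z"
  shows "(\<Sum>j<n. (z ^ t) ^ j) = (if n dvd t then of_nat n else 0)"
proof (cases "n dvd t")
  case True
  then have "z ^ t = 1" using assms by (simp add: primitive_root_def)
  then show ?thesis using True by simp
next
  case False
  then have "z ^ t \<noteq> 1" using assms by (simp add: primitive_root_def)
  moreover have "(z ^ t) ^ n = 1" using assms by (simp add: primitive_root_def flip: power_mult)
  ultimately show ?thesis using False by (simp add: geometric_sum)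
qed

text \<open>The origin of the signs in the count. For odd n the exponent is a multiple of n; for n =
  2 h it is h (n - 1), and z^h = -1 because it squares to 1 without being 1.\<close>

lemma primitive_root_choose_two:
  assumes "primitive_root n z"
  shows "z ^ (n choose 2) = (-1) ^ (n - 1)"
proof -
  have n: "n > 0" and z: "\<And>k. z ^ k = 1 \<longleftrightarrow> n dvd k"
    using assms by (auto simp: primitive_root_def)
  show ?thesis
  proof (cases "even n")
    case True
    then obtain h where h: "n = 2 * h" by (elim evenE)
    then have c: "n choose 2 = h * (n - 1)" by (simp add: choose_two)
    have "z ^ h \<noteq> 1" using z[of h] h n by (auto dest: dvd_imp_le)
    moreover have "(z ^ h) ^ 2 = 1" using z[of n] h by (simp add: mult.commute flip: power_mult)
    ultimately have "z ^ h = -1" by (simp add: power2_eq_1_iff)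
    then show ?thesis by (simp add: c power_mult)
  next
    case False
    then obtain h where h: "n = 2 * h + 1" by (elim oddE)
    then have "n choose 2 = n * h" by (simp add: choose_two)
    then have "z ^ (n choose 2) = 1" by (simp only: z dvd_triv_left)
    then show ?thesis using h by simp
  qed
qed

lemma sum_gcd_eq_reindex:
  fixes f :: "nat \<Rightarrow> 'a :: comm_monoid_add"
  assumes "n > 0" "d dvd n"
  shows "(\<Sum>l | l < n \<and> gcd l n = d. f l) = (\<Sum>l | l < n div d \<and> coprime l (n div d). f (d * l))"
proof (rule sum.reindex_bij_witness[where i = "\<lambda>l. d * l" and j = "\<lambda>l. l div d"])
  have d: "d > 0" using assms by (auto intro: dvd_pos_nat)
  fix l
  assume l: "l \<in> {l. l < n \<and> gcd l n = d}"
  then have dl: "d dvd l" by auto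
  show "d * (l div d) = l" using dl by simp
  show "l div d \<in> {l. l < n div d \<and> coprime l (n div d)}"
    using l dl d assms by (auto simp: div_less_iff_less_mult div_gcd_coprime intro: div_less_mono)
  show "f (d * (l div d)) = f l" using dl by simp
next
  have d: "d > 0" using assms by (auto intro: dvd_pos_nat)
  fix l
  assume l: "l \<in> {l. l < n div d \<and> coprime l (n div d)}"
  show "d * l div d = l" using d by simp
  have "gcd (d * l) (d * (n div d)) = d" using l by (simp add: gcd_mult_distrib_nat[symmetric])
  moreover have "d * l < d * (n div d)" using l d by simp
  ultimately show "d * l \<in> {l. l < n \<and> gcd l n = d}" using assms by simp
qed

text \<open>The Ramanujan sum at argument 1. Grouping all powers of z by their gcd with n gives the
  same kind of sum for the divisors \<open>n div d\<close>; the total is 1 for n = 1 and 0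
  otherwise, the divisor sum that characterises the Moebius function.\<close>

lemma sum_coprime_primitive_root:
  assumes "primitive_root n z"
  shows "(\<Sum>l | l < n \<and> coprime l n. z ^ l) = of_int (moebius_mu n)"
  using assms
proof (induction n arbitrary: z rule: less_induct)
  case (less n)
  then have n: "n > 0" by (simp add: primitive_root_def)
  define R where "R d = (\<Sum>l | l < n \<and> gcd l n = d. z ^ l)" for d
  have fin: "finite {d. d dvd n}" using n by simp
  have R: "R d = (\<Sum>l | l < n div d \<and> coprime l (n div d). (z ^ d) ^ l)" if "d dvd n" for d
    unfolding R_def sum_gcd_eq_reindex[OF n that] by (simp add: power_mult)
  have R': "R d = of_int (moebius_mu (n div d))" if d: "d dvd n" "d \<noteq> 1" for d
  proof -
    have "n div d < n" using d n
      by (metis div_less_dividend dvd_pos_nat nat_neq_iff less_one not_less_iff_gr_or_eq)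
    moreover have "primitive_root (n div d) (z ^ d)"
      using primitive_root_power[OF less.prems, of d] d by (simp add: gcd_nat.absorb1)
    ultimately show ?thesis unfolding R[OF d(1)] by (rule less.IH)
  qed
  have "(\<Sum>d | d dvd n. R d) = (\<Sum>l<n. z ^ l)"
  proof -
    have "(\<Sum>d | d dvd n. \<Sum>l\<in>{l \<in> {..<n}. gcd l n = d}. z ^ l) = (\<Sum>l<n. z ^ l)"
      by (rule sum.group) (use fin in auto)
    then show ?thesis by (simp add: R_def)
  qed
  also have "\<dots> = (if n = 1 then 1 else 0)"
    using sum_primitive_root_powers[OF less.prems, of 1] by simp
  also have "\<dots> = of_int (\<Sum>d | d dvd n. moebius_mu (n div d))"
  proof -
    have "(\<Sum>d | d dvd n. moebius_mu (n div d)) = (\<Sum>d | d dvd n. moebius_mu d)"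
      by (rule sum.reindex_bij_witness[where i = "\<lambda>d. n div d" and j = "\<lambda>d. n div d"])
        (use n in \<open>auto simp: div_div_eq_right\<close>)
    then show ?thesis by (simp add: sum_moebius_mu_divisors[OF n])
  qed
  also have "\<dots> = (\<Sum>d | d dvd n. of_int (moebius_mu (n div d)))" by simp
  finally have "R 1 + (\<Sum>d\<in>{d. d dvd n} - {1}. R d) =
      of_int (moebius_mu n) + (\<Sum>d\<in>{d. d dvd n} - {1}. of_int (moebius_mu (n div d)))"
    using fin by (simp add: sum.remove[of "{d. d dvd n}" 1])
  moreover have "(\<Sum>d\<in>{d. d dvd n} - {1}. R d) =
      (\<Sum>d\<in>{d. d dvd n} - {1}. of_int (moebius_mu (n div d)))"
    by (rule sum.cong) (auto simp: R')
  ultimately have "R 1 = of_int (moebius_mu n)" by simp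
  then show ?case by (simp add: R_def coprime_iff_gcd_eq_1)
qed

section \<open>Multisets weighted by roots of unity\<close>

text \<open>As polynomials, both sides have degree at most e and agree at the e + 1 points
  consisting of 0 and the inverse powers of z.\<close>

lemma prod_one_minus_primitive_root:
  assumes "primitive_root e z"
  shows "(\<Prod>a<e. 1 - fps_const (z ^ a) * fps_X) = 1 - fps_X ^ e"
proof -
  have e: "e > 0" and z: "\<And>k. z ^ k = 1 \<longleftrightarrow> e dvd k"
    using assms by (auto simp: primitive_root_def)
  have z0: "z \<noteq> 0" using z[of e] e by (auto simp: zero_power)
  define P where "P = (\<Prod>a<e. [:1, - (z ^ a):])"
  define Q where "Q = 1 - monom (1::complex) e"
  define A where "A = insert 0 ((\<lambda>a. inverse (z ^ a)) ` {..<e})"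
  have inj: "inj_on (\<lambda>a. inverse (z ^ a)) {..<e}"
  proof (rule linorder_inj_onI)
    fix a b assume ab: "a < b" "a \<in> {..<e}" "b \<in> {..<e}"
    have "z ^ a \<noteq> z ^ b"
    proof
      assume eq: "z ^ a = z ^ b"
      have "z ^ b = z ^ a * z ^ (b - a)" using ab by (simp flip: power_add)
      then have "z ^ (b - a) = 1" using eq z0 by simp
      then have "e dvd b - a" by (simp add: z)
      then show False using ab by (auto dest: dvd_imp_le)
    qed
    then show "inverse (z ^ a) \<noteq> inverse (z ^ b)" by simp
  qed auto
  have cardA: "card A = Suc e"
    unfolding A_def using inj z0 by (subst card_insert_disjoint) (auto simp: card_image)
  have "P = Q"
  proof (rule poly_eqI_degree[where A = A])
    fix x assume "x \<in> A"
    then consider "x = 0" | a where "a < e" "x = inverse (z ^ a)" by (auto simp: A_def)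
    then show "poly P x = poly Q x"
    proof cases
      case 1
      then show ?thesis using e by (simp add: P_def Q_def poly_prod poly_monom)
    next
      case 2
      have "(z ^ a) ^ e = 1" using z[of "a * e"] by (simp flip: power_mult)
      then have "x ^ e = 1" using 2 by (simp add: power_inverse)
      moreover have "poly P x = 0"
        unfolding P_def poly_prod using 2 z0 by (intro prod_zero bexI[of _ a]) auto
      ultimately show ?thesis by (simp add: Q_def poly_monom)
    qed
  next
    have "degree P \<le> (\<Sum>a<e. degree [:1, - (z ^ a):])"
      unfolding P_def by (rule degree_prod_sum_le[unfolded comp_def]) simp
    also have "\<dots> \<le> (\<Sum>a<e. 1)" by (rule sum_mono) simp
    finally show "degree P < card A" by (simp add: cardA)
    have "degree Q \<le> e" unfolding Q_def by (intro degree_diff_le) (simp_all add: degree_monom_le)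
    then show "degree Q < card A" by (simp add: cardA)
  qed
  then have "fps_of_poly P = fps_of_poly Q" by simp
  then show ?thesis
    unfolding P_def Q_def
    by (simp add: fps_of_poly_prod fps_of_poly_diff fps_of_poly_monom fps_of_poly_pCons mult.commute
        flip: fps_const_neg)
qed

lemma prod_one_minus_primitive_root_mult:
  assumes "primitive_root e z"
  shows "(\<Prod>a<q*e. 1 - fps_const (z ^ a) * fps_X) = (1 - fps_X ^ e) ^ q"
proof -
  have ze: "z ^ e = 1" using assms by (simp add: primitive_root_def)
  have "(\<Prod>a<q*e. 1 - fps_const (z ^ a) * fps_X) =
      (\<Prod>i<q. \<Prod>a\<in>{i*e..<i*e+e}. 1 - fps_const (z ^ a) * fps_X)"
    by (rule prod.nat_group[symmetric])
  also have "\<dots> = (\<Prod>i<q. 1 - fps_X ^ e)"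
  proof (rule prod.cong[OF refl])
    fix i
    have "(\<Prod>a\<in>{i*e..<i*e+e}. 1 - fps_const (z ^ a) * fps_X) =
        (\<Prod>a\<in>{0..<e}. 1 - fps_const (z ^ (a + i * e)) * fps_X)"
      using prod.shift_bounds_nat_ivl[of "\<lambda>a. 1 - fps_const (z ^ a) * fps_X" 0 "i * e" e]
      by (simp add: add.commute)
    also have "\<dots> = (\<Prod>a<e. 1 - fps_const (z ^ a) * fps_X)"
      using ze by (simp add: power_add mult.commute[of i] power_mult atLeast0LessThan)
    also have "\<dots> = 1 - fps_X ^ e" by (rule prod_one_minus_primitive_root[OF assms])
    finally show "(\<Prod>a\<in>{i*e..<i*e+e}. 1 - fps_const (z ^ a) * fps_X) = 1 - fps_X ^ e" .
  qed
  finally show ?thesis by simp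
qed

text \<open>The sum is the coefficient of X^n in the product of the geometric series 1 / (1 - z^x X)
  over all x < q e. As x runs through q full periods, this product collapses to (1 -
  X^e)^(-q).\<close>

lemma sum_multisets_primitive_root:
  assumes z: "primitive_root e z" and q: "q > 0"
  shows "(\<Sum>A\<in>multisets_of_size {..<q*e} n. z ^ (\<Sum>\<^sub># A)) =
     (if e dvd n then of_nat ((q + n div e - 1) choose (n div e)) else 0)"
proof -
  have e: "e > 0" using z by (simp add: primitive_root_def)
  define f where "f x = Abs_fps (\<lambda>c. (z ^ x) ^ c)" for x :: nat
  have f: "f x * (1 - fps_const (z ^ x) * fps_X) = 1" for x
  proof -
    have "inverse ((1 - fps_const (z ^ x) * fps_X) ^ 1) = f x"
      by (subst one_minus_const_fps_X_neg_power') (simp_all add: f_def)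
    then have "f x = inverse (1 - fps_const (z ^ x) * fps_X)" by simp
    then show ?thesis by (simp add: inverse_mult_eq_1)
  qed
  have "(\<Sum>A\<in>multisets_of_size {..<q*e} n. z ^ (\<Sum>\<^sub># A)) =
      (\<Sum>A\<in>multisets_of_size {..<q*e} n. \<Prod>x<q*e. f x $ count A x)"
  proof (rule sum.cong[OF refl])
    fix A assume "A \<in> multisets_of_size {..<q*e} n"
    then have A: "set_mset A \<subseteq> {..<q*e}" by (rule multisets_of_size_subset)
    have "z ^ (\<Sum>\<^sub># A) = (\<Prod>x\<in>#A. z ^ x)" by (induction A) (simp_all add: power_add)
    also have "\<dots> = (\<Prod>x\<in>set_mset A. (z ^ x) ^ count A x)"
      by (rule image_prod_mset_multiplicity)
    also have "\<dots> = (\<Prod>x<q*e. (z ^ x) ^ count A x)"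
      by (rule prod.mono_neutral_left) (use A in \<open>auto simp: not_in_iff\<close>)
    finally show "z ^ (\<Sum>\<^sub># A) = (\<Prod>x<q*e. f x $ count A x)" by (simp add: f_def)
  qed
  also have "\<dots> = (\<Prod>x<q*e. f x) $ n" by (rule fps_prod_nth'[symmetric]) simp
  also have "(\<Prod>x<q*e. f x) = inverse ((1 - fps_X ^ e) ^ q)"
  proof -
    have "(1 - fps_const (z ^ x) * fps_X) * f x = 1" for x
      using f[of x] by (simp only: mult.commute)
    then have "(\<Prod>x<q*e. 1 - fps_const (z ^ x) * fps_X) * (\<Prod>x<q*e. f x) = 1"
      unfolding prod.distrib[symmetric] by simp
    then show ?thesis
      unfolding prod_one_minus_primitive_root_mult[OF z] by (metis fps_inverse_unique)
  qed
  also have "\<dots> = inverse ((1 - fps_const 1 * fps_X) ^ q) oo (fps_X ^ e)"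
    using e by (subst fps_inverse_compose)
      (simp_all add: fps_compose_power[symmetric] fps_compose_sub_distrib fps_nth_power_0)
  also have "\<dots> = Abs_fps (\<lambda>k. of_nat ((q + k - 1) choose k) * 1 ^ k) oo (fps_X ^ e)"
    by (subst one_minus_const_fps_X_neg_power'[OF q]) simp
  also have "\<dots> $ n = (if e dvd n then of_nat ((q + n div e - 1) choose (n div e)) else 0)"
    using e by (simp add: fps_nth_compose_X_power)
  finally show ?thesis .
qed

text \<open>These encode the S_n-orbits on \<open>Dset m n\<close>; entries are natural numbers
  because their sum serves as an exponent.\<close>

definition multiset_classes :: "nat \<Rightarrow> nat \<Rightarrow> nat multiset set" where
  "multiset_classes m n =
     {A \<in> multisets_of_size {..<m*n} n. [int (\<Sum>\<^sub># A) = genus m n] (mod int (m * n))}"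


text \<open>The number added to s is a natural representative of -g modulo m n, fit to be an
  exponent. Its two summands later produce the Ramanujan sum and the sign, respectively.\<close>

lemma dvd_iff_cong_uminus_genus:
  assumes "m * n > 0"
  shows "m * n dvd s + (n - 1 + m * (n choose 2) * (m * n - 1)) \<longleftrightarrow>
     [int s = genus m n] (mod int (m * n))"
proof -
  define N where "N = m * n"
  have N: "N > 0" "n > 0" using assms by (auto simp: N_def)
  have "int (n - 1 + m * (n choose 2) * (N - 1)) =
      int n - 1 + int m * int (n choose 2) * (int N - 1)"
    using N by (simp add: of_nat_diff)
  also have "\<dots> = int N * (int m * int (n choose 2)) - genus m n"
    by (simp add: genus_def algebra_simps)
  finally have "int (s + (n - 1 + m * (n choose 2) * (N - 1))) =
      int N * (int m * int (n choose 2)) + (int s - genus m n)" by simp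
  then have "N dvd s + (n - 1 + m * (n choose 2) * (N - 1)) \<longleftrightarrow> int N dvd int s - genus m n"
    by (metis dvd_add_times_triv_left_iff mult.commute int_dvd_int_iff)
  then show ?thesis by (simp only: N_def cong_iff_dvd_diff)
qed

text \<open>A roots of unity filter for the condition on the sum. Each surviving character is the
  l-th power of a primitive n-th root of unity; its binomial and its sign depend only on gcd(l, n),
  and the remaining factor sums to a Moebius value.\<close>

lemma card_multiset_classes:
  assumes mn: "m \<ge> 1" "n \<ge> 1"
  shows "int (m * n * card (multiset_classes m n)) =
    (\<Sum>d | d dvd n. (-1) ^ (m * (n + d)) * moebius_mu (n div d) * int (((m + 1) * d - 1) choose d))"
proof -
  define N where "N = m * n"
  have N: "N > 0" and n: "n > 0" and m: "m > 0" using mn by (simp_all add: N_def)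
  obtain w where w: "primitive_root N w" using primitive_root_exists[OF N] .
  define G where "G = n - 1 + m * (n choose 2) * (N - 1)"
  define B where "B d = (complex_of_nat (((m + 1) * d - 1) choose d))" for d
  let ?A = "multisets_of_size {..<N} n"
  have fin: "finite ?A" by (rule finite_multisets_of_size) simp
  have inner: "(\<Sum>A\<in>?A. (w ^ j) ^ (\<Sum>\<^sub># A)) =
      (if N div gcd j N dvd n
       then of_nat ((gcd j N + n div (N div gcd j N) - 1) choose (n div (N div gcd j N))) else 0)" for j
  proof -
    have "gcd j N * (N div gcd j N) = N" "gcd j N > 0" using N by simp_all
    then show ?thesis
      using sum_multisets_primitive_root[OF primitive_root_power[OF w, of j], of "gcd j N" n] by simp
  qed
  have "of_nat N * complex_of_nat (card (multiset_classes m n)) =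
      (\<Sum>A\<in>?A. if N dvd (\<Sum>\<^sub># A) + G then of_nat N else 0)"
  proof -
    have "multiset_classes m n = {A \<in> ?A. N dvd (\<Sum>\<^sub># A) + G}"
      unfolding multiset_classes_def G_def N_def dvd_iff_cong_uminus_genus[OF N[unfolded N_def]] ..
    then show ?thesis using fin by (simp add: sum.If_cases Int_def)
  qed
  also have "\<dots> = (\<Sum>A\<in>?A. \<Sum>j<N. (w ^ ((\<Sum>\<^sub># A) + G)) ^ j)"
    by (simp only: sum_primitive_root_powers[OF w])
  also have "\<dots> = (\<Sum>j<N. \<Sum>A\<in>?A. (w ^ ((\<Sum>\<^sub># A) + G)) ^ j)"
    by (rule sum.swap)
  also have "\<dots> = (\<Sum>j<N. (w ^ j) ^ G * (\<Sum>A\<in>?A. (w ^ j) ^ (\<Sum>\<^sub># A)))"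
    by (simp add: sum_distrib_left power_mult_distrib ring_distribs mult.commute add.commute
        flip: power_mult power_add)
  also have "\<dots> = (\<Sum>j\<in>(*) m ` {..<n}. (w ^ j) ^ G * (\<Sum>A\<in>?A. (w ^ j) ^ (\<Sum>\<^sub># A)))"
  proof (rule sum.mono_neutral_right)
    show "(*) m ` {..<n} \<subseteq> {..<N}" using m by (auto simp: N_def)
    show "\<forall>j\<in>{..<N} - (*) m ` {..<n}. (w ^ j) ^ G * (\<Sum>A\<in>?A. (w ^ j) ^ (\<Sum>\<^sub># A)) = 0"
    proof
      fix j assume j: "j \<in> {..<N} - (*) m ` {..<n}"
      \<comment> \<open>\<open>N div gcd j N\<close> is the order of w^j, and the inner sum vanishes
        unless it divides n = N / m, that is, unless m divides j.\<close>
      have "\<not> N div gcd j N dvd n"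
      proof
        assume "N div gcd j N dvd n"
        then have "gcd j N * (N div gcd j N) dvd gcd j N * n" by (rule mult_dvd_mono[OF dvd_refl])
        then have "m * n dvd gcd j N * n" by (simp add: N_def)
        then have "m dvd gcd j N" using n by simp
        then obtain l where "j = m * l" by (elim dvdE) (metis dvdE gcd_dvd1 dvd_trans dvd_triv_left)
        then show False using j m by (auto simp: N_def)
      qed
      then show "(w ^ j) ^ G * (\<Sum>A\<in>?A. (w ^ j) ^ (\<Sum>\<^sub># A)) = 0" unfolding inner by simp
    qed
  qed simp
  also have "\<dots> = (\<Sum>l<n. (w ^ (m * l)) ^ G * (\<Sum>A\<in>?A. (w ^ (m * l)) ^ (\<Sum>\<^sub># A)))"
    using m by (subst sum.reindex) (auto simp: inj_on_def)
  also have "\<dots> = (\<Sum>l<n. (-1) ^ (m * (n + gcd l n)) * B (gcd l n) * ((w ^ m) ^ (n - 1)) ^ l)"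
  proof (rule sum.cong[OF refl])
    fix l assume "l \<in> {..<n}"
    define d where "d = gcd l n"
    have d: "d > 0" "d dvd n" using n by (simp_all add: d_def)
    have gcd: "gcd (m * l) N = m * d" by (simp add: N_def d_def gcd_mult_distrib_nat)
    have e: "N div (m * d) = n div d" using m by (simp add: N_def)
    have "n div (n div d) = d" using d n by (simp add: div_div_eq_right)
    moreover have "n div d dvd n" using d by (metis dvd_mult_div_cancel dvd_triv_right)
    ultimately have 1: "(\<Sum>A\<in>?A. (w ^ (m * l)) ^ (\<Sum>\<^sub># A)) = B d"
      unfolding inner gcd e using d by (simp add: B_def ring_distribs add.commute)
    have wm: "primitive_root n (w ^ m)"
      using primitive_root_power[OF w, of m] m by (simp add: N_def)
    have "(w ^ (m * l)) ^ G = ((w ^ m) ^ (n - 1)) ^ l * ((w ^ m) ^ (n choose 2)) ^ (m * l * (N - 1))"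
      unfolding G_def power_mult[symmetric] power_add[symmetric]
      by (rule arg_cong[where f = "\<lambda>k. w ^ k"]) (simp add: algebra_simps)
    also have "((w ^ m) ^ (n choose 2)) ^ (m * l * (N - 1)) = (-1) ^ ((n - 1) * (m * l * (N - 1)))"
      unfolding primitive_root_choose_two[OF wm] by (simp add: power_mult)
    also have "\<dots> = (-1) ^ (m * (n + d))"
    proof -
      \<comment> \<open>For even n, both n - 1 and N - 1 are odd, and l has the parity of d = gcd(l,
        n). For odd n, both exponents are even.\<close>
      have "even ((n - 1) * (m * l * (N - 1))) \<longleftrightarrow> even (m * (n + d))"
      proof (cases "even n")
        case True
        have "even l \<longleftrightarrow> even d" unfolding d_def using True by simp
        moreover have "odd (n - 1)" "odd (N - 1)" using True n N by (simp_all add: N_def)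
        ultimately show ?thesis using True by simp
      next
        case False
        have "odd d" using False d(2) by (meson dvd_trans)
        then show ?thesis using False n by simp
      qed
      then show ?thesis by (simp add: minus_one_power_iff)
    qed
    finally show "(w ^ (m * l)) ^ G * (\<Sum>A\<in>?A. (w ^ (m * l)) ^ (\<Sum>\<^sub># A)) =
        (-1) ^ (m * (n + gcd l n)) * B (gcd l n) * ((w ^ m) ^ (n - 1)) ^ l"
      unfolding 1 by (simp add: d_def mult_ac)
  qed
  also have "\<dots> = (\<Sum>d | d dvd n. \<Sum>l\<in>{l \<in> {..<n}. gcd l n = d}.
      (-1) ^ (m * (n + gcd l n)) * B (gcd l n) * ((w ^ m) ^ (n - 1)) ^ l)"
    by (rule sum.group[symmetric]) (use n in auto)
  also have "\<dots> = (\<Sum>d | d dvd n. (-1) ^ (m * (n + d)) * of_int (moebius_mu (n div d)) * B d)"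
  proof (rule sum.cong[OF refl])
    fix d assume "d \<in> {d. d dvd n}"
    then have d: "d dvd n" by simp
    define z where "z = (w ^ m) ^ (n - 1)"
    have wm: "primitive_root n (w ^ m)"
      using primitive_root_power[OF w, of m] m by (simp add: N_def)
    \<comment> \<open>So raising to the power n - 1 gives a primitive n-th root again.\<close>
    have "coprime (n - 1) n" using n by (metis Suc_pred' coprime_Suc_right_nat coprime_commute)
    then have z: "primitive_root n z"
      using primitive_root_power[OF wm, of "n - 1"] by (simp add: z_def)
    have "(\<Sum>l\<in>{l \<in> {..<n}. gcd l n = d}. (-1) ^ (m * (n + gcd l n)) * B (gcd l n) * z ^ l) =
        (-1) ^ (m * (n + d)) * B d * (\<Sum>l | l < n \<and> gcd l n = d. z ^ l)"
      by (simp add: sum_distrib_left)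
    also have "(\<Sum>l | l < n \<and> gcd l n = d. z ^ l) = (\<Sum>l | l < n div d \<and> coprime l (n div d). (z ^ d) ^ l)"
      unfolding sum_gcd_eq_reindex[OF n d] by (simp add: power_mult)
    also have "\<dots> = of_int (moebius_mu (n div d))"
      using primitive_root_power[OF z, of d] d
      by (intro sum_coprime_primitive_root) (simp add: gcd_nat.absorb1)
    finally show "(\<Sum>l\<in>{l \<in> {..<n}. gcd l n = d}.
        (-1) ^ (m * (n + gcd l n)) * B (gcd l n) * ((w ^ m) ^ (n - 1)) ^ l) =
        (-1) ^ (m * (n + d)) * of_int (moebius_mu (n div d)) * B d"
      by (simp add: z_def mult_ac)
  qed
  finally have "complex_of_int (int (m * n * card (multiset_classes m n))) =
      of_int (\<Sum>d | d dvd n. (-1) ^ (m * (n + d)) * moebius_mu (n div d) *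
        int (((m + 1) * d - 1) choose d))"
    by (simp add: N_def B_def)
  then show ?thesis by (simp only: of_int_eq_iff)
qed

section \<open>Freeness of the shift on multisets\<close>

definition rot :: "nat \<Rightarrow> nat \<Rightarrow> nat \<Rightarrow> nat multiset \<Rightarrow> nat multiset" where
  "rot m n j A = {#(a + j * m) mod (m * n). a \<in># A#}"

lemma rot_add: "rot m n i (rot m n j A) = rot m n (i + j) A"
  by (simp add: rot_def multiset.map_comp comp_def mod_simps algebra_simps)

lemma rot_cong:
  assumes "[i = j] (mod n)"
  shows "rot m n i A = rot m n j A"
proof -
  have "(i * m) mod (m * n) = (j * m) mod (m * n)"
    using assms by (simp add: cong_def mult.commute[of _ m] mult_mod_right[symmetric])
  then have "(a + i * m) mod (m * n) = (a + j * m) mod (m * n)" for a by (rule mod_add_cong[OF refl])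
  then show ?thesis by (simp add: rot_def)
qed

lemma rot_0:
  assumes "set_mset A \<subseteq> {..<m * n}"
  shows "rot m n 0 A = A"
proof -
  have "rot m n 0 A = {#a. a \<in># A#}"
    unfolding rot_def by (rule image_mset_cong) (use assms in auto)
  then show ?thesis by simp
qed

lemma rot_multiple:
  assumes "rot m n j A = A" "set_mset A \<subseteq> {..<m * n}"
  shows "rot m n (k * j) A = A"
  by (induction k) (simp_all add: rot_0 assms flip: rot_add)

lemma sum_mset_split_classes:
  fixes f :: "'a \<Rightarrow> 'b :: comm_monoid_add"
  assumes "\<And>a. a \<in># A \<Longrightarrow> h a < e"
  shows "(\<Sum>a\<in>#A. f a) = (\<Sum>i<(e::nat). \<Sum>a\<in>#A. if h a = i then f a else 0)"
  using assms
proof (induction A)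
  case (add x A)
  then have "(\<Sum>i<e. if h x = i then f x else 0) = f x" by simp
  then show ?case using add by (simp add: sum.distrib)
qed simp

text \<open>
  A multiset invariant under a rotation of order \<open>e\<close> is a union of \<open>d = n / e\<close> cosets of the subgroup
  of order \<open>e\<close>, so its sum is congruent to \<open>g - 1\<close> modulo \<open>e\<close>.
\<close>

lemma rot_free:
  assumes mn: "m > 0" "n > 0" and A: "A \<in> multiset_classes m n" and rot: "rot m n j A = A"
  shows "n dvd j"
proof -
  define N where "N = m * n"
  have sub: "set_mset A \<subseteq> {..<m * n}" and size: "size A = n"
    and sum: "[int (\<Sum>\<^sub># A) = genus m n] (mod int N)"
    using A by (auto simp: multiset_classes_def multisets_of_size_def N_def)
  define d where "d = gcd j n"
  have d: "d > 0" "d dvd n" using mn by (simp_all add: d_def)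
  define e where "e = n div d"
  have de: "n = d * e" using d by (simp add: e_def)
  have e: "e > 0" using de mn by auto
  define s where "s = d * m"
  have s: "s > 0" using d mn by (simp add: s_def)
  have Ns: "N = e * s" by (simp add: N_def s_def de)
  \<comment> \<open>By Bezout, invariance under rotation by j gives invariance under rotation by d =
    gcd(j, n).\<close>
  obtain k where "[j * k = d] (mod n)" unfolding d_def using cong_solve_nat by blast
  then have "rot m n (k * j) A = rot m n d A" by (intro rot_cong) (simp add: mult.commute)
  then have rotd: "rot m n d A = A" using rot_multiple[OF rot sub] by simp
  have lt: "a < N" if "a \<in># A" for a using sub that by (auto simp: N_def)
  have dive: "a div s < e" if "a \<in># A" for a
    using lt[OF that] s by (simp add: Ns less_mult_imp_div_less)
  \<comment> \<open>\<int>/N is cut into e blocks of length s, and rotation by s moves block i to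
    block i + 1, preserving offsets. \<open>F \<phi> i\<close> sums \<phi> over the offsets in block
    i: the constant 1 counts elements, the identity adds offsets.\<close>
  define F where "F \<phi> i = (\<Sum>a\<in>#A. if a div s = i then \<phi> (a mod s) else 0)" for \<phi> :: "nat \<Rightarrow> nat" and i
  have step: "F \<phi> (Suc i) = F \<phi> i" if i: "Suc i < e" for \<phi> i
  proof -
    have "F \<phi> (Suc i) = (\<Sum>a\<in>#rot m n d A. if a div s = Suc i then \<phi> (a mod s) else 0)"
      unfolding rotd F_def ..
    also have "\<dots> = (\<Sum>a\<in>#A. if (a + s) mod N div s = Suc i then \<phi> ((a + s) mod N mod s) else 0)"
      unfolding rot_def s_def[symmetric] N_def[symmetric]
      by (simp add: multiset.map_comp comp_def)
    also have "\<dots> = F \<phi> i"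
      unfolding F_def
    proof (rule arg_cong[where f = sum_mset], rule image_mset_cong)
      fix a assume a: "a \<in># A"
      show "(if (a + s) mod N div s = Suc i then \<phi> ((a + s) mod N mod s) else 0) =
          (if a div s = i then \<phi> (a mod s) else 0)"
      proof (cases "a + s < N")
        case True
        then show ?thesis using s by simp
      next
        case False
        \<comment> \<open>Wrap-around: the element comes from the last block and lands in block 0,
          so it contributes to neither side.\<close>
        have "s \<le> N" using e by (simp add: Ns)
        then have "(a + s) mod N = a + s - N"
          using False lt[OF a] by (simp add: le_mod_geq)
        moreover have "a + s - N < s" using lt[OF a] False by linarith
        moreover have "a div s \<ge> e - 1"
        proof -
          have "(e - 1) * s \<le> a" using False by (simp add: Ns diff_mult_distrib)
          then show ?thesis using s by (simp add: less_eq_div_iff_mult_less_eq)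
        qed
        ultimately show ?thesis using i by auto
      qed
    qed
    finally show ?thesis .
  qed
  have F: "F \<phi> i = F \<phi> 0" if "i < e" for \<phi> i
    using that by (induction i) (auto simp: step)
  have total: "(\<Sum>a\<in>#A. \<phi> (a mod s)) = e * F \<phi> 0" for \<phi>
  proof -
    have "(\<Sum>a\<in>#A. \<phi> (a mod s)) = (\<Sum>i<e. F \<phi> i)"
      unfolding F_def by (rule sum_mset_split_classes) (rule dive)
    also have "\<dots> = (\<Sum>i<e. F \<phi> 0)" by (rule sum.cong[OF refl], rule F) simp
    finally show ?thesis by simp
  qed
  have "n = e * F (\<lambda>_. 1) 0" using total[of "\<lambda>_. 1"] size by simp
  then have F1: "F (\<lambda>_. 1) 0 = d" using de e by simp
  have "(\<Sum>a\<in>#A. a div s) = (\<Sum>i<e. \<Sum>a\<in>#A. if a div s = i then a div s else 0)"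
    by (rule sum_mset_split_classes) (rule dive)
  also have "\<dots> = (\<Sum>i<e. i * F (\<lambda>_. 1) i)"
    unfolding F_def sum_mset_distrib_left
    by (intro sum.cong refl arg_cong[where f = sum_mset] image_mset_cong) auto
  also have "\<dots> = (\<Sum>i<e. i * d)"
  proof (rule sum.cong[OF refl])
    fix i assume "i \<in> {..<e}"
    then show "i * F (\<lambda>_. 1) i = i * d" using F[of i "\<lambda>_. 1"] F1 by simp
  qed
  also have "\<dots> = (\<Sum>i<e. i) * d" by (simp add: sum_distrib_right)
  also have "(\<Sum>i<e. i) = e choose 2"
    by (induction e) (simp_all add: numeral_2_eq_2)
  finally have q: "(\<Sum>a\<in>#A. a div s) = (e choose 2) * d" .
  have "(\<Sum>\<^sub># A) = (\<Sum>a\<in>#A. s * (a div s) + a mod s)" by simp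
  also have "\<dots> = s * (\<Sum>a\<in>#A. a div s) + (\<Sum>a\<in>#A. a mod s)"
    by (simp only: sum_mset.distrib sum_mset_distrib_left)
  also have "\<dots> = m * d * d * (e choose 2) + e * F (\<lambda>x. x) 0"
    unfolding q total[of "\<lambda>x. x"] by (simp add: s_def)
  finally have sumA: "int (\<Sum>\<^sub># A) =
      int m * (int d * int d * int (e choose 2)) + int e * int (F (\<lambda>x. x) 0)"
    by (simp add: mult_ac)
  \<comment> \<open>For n = d e, pairs are split according to d groups of size e, up to multiples of
    e; the leading term cancels the one in the sum of A, leaving a multiple of e minus the constant
    1 of the genus.\<close>
  have choose: "int (n choose 2) = int d * int d * int (e choose 2) + int e * int (d choose 2)"
  proof -
    have "2 * (int d * int d * int (e choose 2) + int e * int (d choose 2)) =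
        int d * int d * (2 * int (e choose 2)) + int e * (2 * int (d choose 2))"
      by (simp only: algebra_simps)
    also have "\<dots> = 2 * int (n choose 2)"
      unfolding int_choose_two by (simp add: de algebra_simps)
    finally show ?thesis by simp
  qed
  have "int e dvd int N" by (simp add: Ns)
  then have "int e dvd int (\<Sum>\<^sub># A) - genus m n"
    using sum unfolding cong_iff_dvd_diff by (rule dvd_trans)
  also have "int (\<Sum>\<^sub># A) - genus m n =
      int e * (int (F (\<lambda>x. x) 0) - int m * int (d choose 2) + int d) - 1"
    unfolding sumA genus_def choose by (simp add: de algebra_simps)
  finally have "int e dvd int e * (int (F (\<lambda>x. x) 0) - int m * int (d choose 2) + int d) -
      (int e * (int (F (\<lambda>x. x) 0) - int m * int (d choose 2) + int d) - 1)"
    by (rule dvd_diff[OF dvd_triv_left])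
  then have "int e dvd 1" by simp
  then have "e = 1" by simp
  then show ?thesis using de by (metis d_def gcd_dvd1 mult.right_neutral)
qed

section \<open>Orbits of shift classes and multisets of values\<close>

definition values_mset :: "nat \<Rightarrow> (nat \<Rightarrow> int) \<Rightarrow> nat multiset" where
  "values_mset n x = {#nat (x i). i \<in># mset_set {1..n}#}"

lemma values_mset_comp_permutes:
  assumes "\<sigma> permutes {1..n}"
  shows "values_mset n (x \<circ> \<sigma>) = values_mset n x"
proof -
  have "image_mset \<sigma> (mset_set {1..n}) = mset_set {1..n}"
    using permutes_inj_on[OF assms] permutes_image[OF assms] by (simp add: image_mset_mset_set)
  then have "values_mset n x = image_mset (\<lambda>i. nat (x i)) (image_mset \<sigma> (mset_set {1..n}))"
    by (simp only: values_mset_def)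
  then show ?thesis by (simp add: values_mset_def multiset.map_comp comp_def)
qed

lemma Dset_bounds:
  assumes "x \<in> Dset m n" "i \<in> {1..n}"
  shows "0 \<le> x i" "x i < int (m * n)"
  using assms by (auto simp: Dset_def PiE_def Pi_def)

lemma values_mset_eqE:
  assumes x: "x \<in> Dset m n" and y: "y \<in> Dset m n" and eq: "values_mset n x = values_mset n y"
  obtains \<sigma> where "\<sigma> permutes {1..n}" "y = x \<circ> \<sigma>"
proof -
  obtain \<sigma> where \<sigma>: "\<sigma> permutes {1..n}" "\<forall>i\<in>{1..n}. nat (y i) = nat (x (\<sigma> i))"
    using image_mset_eq_implies_permutes[OF _ eq[symmetric, unfolded values_mset_def]] by auto
  have "y = x \<circ> \<sigma>"
  proof
    fix i
    show "y i = (x \<circ> \<sigma>) i"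
    proof (cases "i \<in> {1..n}")
      case True
      then have "\<sigma> i \<in> {1..n}" using permutes_in_image[OF \<sigma>(1)] by blast
      then have "0 \<le> x (\<sigma> i)" "0 \<le> y i" using Dset_bounds(1) x y True by blast+
      moreover have "nat (y i) = nat (x (\<sigma> i))" using \<sigma>(2) True by blast
      ultimately show ?thesis by simp
    next
      case False
      then show ?thesis using x y permutes_not_in[OF \<sigma>(1) False]
        by (simp add: Dset_def PiE_def extensional_def)
    qed
  qed
  then show thesis using that \<sigma>(1) by blast
qed

lemma values_mset_image: "values_mset n ` Dset m n = multiset_classes m n"
proof (intro equalityI subsetI)
  fix A assume "A \<in> values_mset n ` Dset m n"
  then obtain x where x: "x \<in> Dset m n" and A: "A = values_mset n x" by blast
  have "int (\<Sum>\<^sub># A) = (\<Sum>i\<in>{1..n}. int (nat (x i)))"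
    by (simp add: A values_mset_def sum_unfold_sum_mset multiset.map_comp comp_def)
  also have "\<dots> = (\<Sum>i\<in>{1..n}. x i)"
    by (rule sum.cong) (use Dset_bounds(1)[OF x] in auto)
  finally have "[int (\<Sum>\<^sub># A) = genus m n] (mod int (m * n))" using x by (simp add: Dset_def)
  moreover have "nat (x i) < m * n" if "i \<in> {1..n}" for i
    using Dset_bounds[OF x that] by linarith
  then have "set_mset A \<subseteq> {..<m * n}" by (auto simp: A values_mset_def)
  ultimately show "A \<in> multiset_classes m n"
    by (simp add: multiset_classes_def multisets_of_size_def A values_mset_def)
next
  fix A assume A: "A \<in> multiset_classes m n"
  obtain xs where xs: "mset xs = A" using ex_mset by blast
  have sub: "set_mset A \<subseteq> {..<m * n}" and size: "length xs = n"
    and sum: "[int (\<Sum>\<^sub># A) = genus m n] (mod int (m * n))"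
    using A xs by (auto simp: multiset_classes_def multisets_of_size_def)
  define x where "x = (\<lambda>i\<in>{1..n}. int (xs ! (i - 1)))"
  have "values_mset n x = {#xs ! (i - 1). i \<in># mset_set {1..n}#}"
    unfolding values_mset_def by (rule image_mset_cong) (simp add: x_def)
  also have "\<dots> = image_mset ((!) xs) (image_mset (\<lambda>i. i - 1) (mset_set {1..n}))"
    by (simp add: multiset.map_comp comp_def)
  also have "image_mset (\<lambda>i. i - 1) (mset_set {1..n}) = mset_set {0..<n}"
  proof -
    have "inj_on (\<lambda>i. i - 1) {1..n}" by (auto simp: inj_on_def)
    moreover have "(\<lambda>i. i - 1) ` {1..n} = {0..<n}"
      by (auto simp: image_iff intro!: bexI[of _ "Suc _"])
    ultimately show ?thesis by (simp add: image_mset_mset_set)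
  qed
  also have "image_mset ((!) xs) (mset_set {0..<n}) = mset (map ((!) xs) [0..<n])"
    by (simp flip: mset_upt)
  also have "map ((!) xs) [0..<n] = xs" using size map_nth by blast
  finally have vx: "values_mset n x = A" using xs by simp
  have "(\<Sum>i\<in>{1..n}. x i) = (\<Sum>i\<in>{1..n}. int (nat (x i)))"
    by (rule sum.cong) (auto simp: x_def)
  also have "\<dots> = int (\<Sum>\<^sub># A)" unfolding vx[symmetric]
    by (simp add: values_mset_def sum_unfold_sum_mset multiset.map_comp comp_def)
  finally have "[(\<Sum>i\<in>{1..n}. x i) = genus m n] (mod int (m * n))" using sum by simp
  moreover have "xs ! (i - 1) < m * n" if "i \<in> {1..n}" for i
  proof -
    have "xs ! (i - 1) \<in> set xs" using that size by (intro nth_mem) auto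
    then show ?thesis using sub xs by auto
  qed
  then have "x i \<le> int (m * n) - 1" if "i \<in> {1..n}" for i
    using that by (force simp: x_def simp del: of_nat_mult)
  then have "x \<in> {1..n} \<rightarrow>\<^sub>E {0..int (m * n) - 1}"
    by (auto simp: PiE_def Pi_def x_def simp del: of_nat_mult)
  ultimately have "x \<in> Dset m n" by (simp add: Dset_def)
  then show "A \<in> values_mset n ` Dset m n" using vx by blast
qed

lemma shift_pow_in_Dset:
  assumes mn: "m > 0" "n > 0" and x: "x \<in> Dset m n"
  shows "(shift m n ^^ j) x \<in> Dset m n"
proof -
  have N: "int (m * n) > 0" using mn by (simp del: of_nat_mult)
  let ?y = "\<lambda>i\<in>{1..n}. (x i + int (j * m)) mod int (m * n)"
  have "[(\<Sum>i\<in>{1..n}. ?y i) = (\<Sum>i\<in>{1..n}. x i + int (j * m))] (mod int (m * n))"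
    by (rule cong_sum) (simp add: cong_def)
  also have "(\<Sum>i\<in>{1..n}. x i + int (j * m)) = (\<Sum>i\<in>{1..n}. x i) + int (m * n) * int j"
    by (simp add: sum.distrib)
  also have "[\<dots> = (\<Sum>i\<in>{1..n}. x i)] (mod int (m * n))"
    unfolding cong_def by (rule mod_mult_self2)
  also have "[(\<Sum>i\<in>{1..n}. x i) = genus m n] (mod int (m * n))" using x by (simp add: Dset_def)
  finally have "[(\<Sum>i\<in>{1..n}. ?y i) = genus m n] (mod int (m * n))" .
  moreover have "?y i \<le> int (m * n) - 1" if "i \<in> {1..n}" for i
    using pos_mod_bound[OF N, of "x i + int (j * m)"] that by (simp del: of_nat_mult)
  moreover have "?y i \<ge> 0" if "i \<in> {1..n}" for i
    using pos_mod_sign[OF N, of "x i + int (j * m)"] that by (simp del: of_nat_mult)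
  ultimately have "?y \<in> Dset m n"
    unfolding Dset_def by (simp add: PiE_def Pi_def del: of_nat_mult)
  then show ?thesis by (simp only: shift_pow[OF x])
qed

lemma values_mset_shift_pow:
  assumes x: "x \<in> Dset m n"
  shows "values_mset n ((shift m n ^^ j) x) = rot m n j (values_mset n x)"
proof -
  have "nat ((x i + int (j * m)) mod int (m * n)) = (nat (x i) + j * m) mod (m * n)"
    if "i \<in> {1..n}" for i
  proof -
    have "x i = int (nat (x i))" using Dset_bounds(1)[OF x that] by simp
    then have "(x i + int (j * m)) mod int (m * n) = int ((nat (x i) + j * m) mod (m * n))"
      by (metis of_nat_add of_nat_mod)
    then show ?thesis by (simp only: nat_int)
  qed
  then show ?thesis unfolding shift_pow[OF x] values_mset_def rot_def multiset.map_comp comp_def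
    by (intro image_mset_cong) simp
qed

text \<open>
  Since the shift acts freely on the multisets of values, each \<open>S\<^sub>n\<close>-orbit of shift classes
  corresponds to exactly \<open>n\<close> multisets.
\<close>

lemma card_orbits_Dhat:
  assumes mn: "m > 0" "n > 0"
  shows "n * card (orbits (sym_group n) (Dhat m n) (coord_action_classes (Dhat m n))) =
    card (multiset_classes m n)"
proof -
  let ?G = "sym_group n" and ?\<phi> = "coord_action_classes (Dhat m n)"
  let ?O = "orbits ?G (Dhat m n) ?\<phi>"
  interpret group_action ?G "Dhat m n" ?\<phi> by (rule group_action_Dhat)
  \<comment> \<open>The multisets realised in an orbit U. These sets partition
    \<open>multiset_classes m n\<close>, and each is a rotation orbit of size n.\<close>
  define V where "V U = values_mset n ` \<Union>U" for U
  have Dhat: "\<Union>(Dhat m n) = Dset m n"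
    unfolding Dhat_def by (rule Union_quotient[OF equiv_shift_rel])
  have cover: "\<Union>(V ` ?O) = multiset_classes m n"
  proof -
    have "\<Union>(V ` ?O) = values_mset n ` \<Union>(\<Union>?O)" by (auto simp: V_def)
    then show ?thesis by (simp only: orbits_coverture Dhat values_mset_image)
  qed
  have act: "?\<phi> \<sigma> C = (\<lambda>x. x \<circ> inv' \<sigma>) ` C" if "C \<in> Dhat m n" for \<sigma> C
    using that by (simp add: coord_action_classes_def)
  have disj: "U = U'" if U: "U \<in> ?O" "U' \<in> ?O" and A: "A \<in> V U" "A \<in> V U'" for U U' A
  proof -
    obtain C x where C: "C \<in> U" "x \<in> C" "A = values_mset n x" using A by (auto simp: V_def)
    obtain C' y where C': "C' \<in> U'" "y \<in> C'" "A = values_mset n y" using A by (auto simp: V_def)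
    have CD: "C \<in> Dhat m n" "C' \<in> Dhat m n" using C C' U orbits_coverture by blast+
    have "x \<in> Dset m n" "y \<in> Dset m n" using CD C C' Dhat by blast+
    then obtain \<sigma> where \<sigma>: "\<sigma> permutes {1..n}" "y = x \<circ> \<sigma>"
      using values_mset_eqE C(3) C'(3) by metis
    have s: "inv' \<sigma> \<in> carrier ?G" using \<sigma>(1) by (simp add: sym_group_carrier permutes_inv)
    have img: "?\<phi> (inv' \<sigma>) C = (\<lambda>x. x \<circ> \<sigma>) ` C"
      using act[OF CD(1)] \<sigma>(1) by (simp add: permutes_inv_inv)
    have "(\<lambda>x. x \<circ> \<sigma>) ` C \<in> Dhat m n" by (rule Dhat_comp_permutes[OF \<sigma>(1) CD(1)])
    moreover have "y \<in> (\<lambda>x. x \<circ> \<sigma>) ` C" using C(2) \<sigma>(2) by blast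
    ultimately have "C' = (\<lambda>x. x \<circ> \<sigma>) ` C"
      using CD(2) C'(2) quotient_disj[OF equiv_shift_rel, of C' m n "(\<lambda>x. x \<circ> \<sigma>) ` C"]
      unfolding Dhat_def by blast
    then have "C' \<in> orbit ?G ?\<phi> C" using img s unfolding orbit_def by blast
    moreover have "C \<in> orbit ?G ?\<phi> C" by (rule orbit_refl[OF CD(1)])
    moreover have orbC: "orbit ?G ?\<phi> C \<in> ?O" using CD(1) by (auto simp: orbits_def)
    ultimately show ?thesis using C(1) C'(1) U disjoint_union by (metis disjoint_iff)
  qed
  have cardV: "card (V U) = n" if U: "U \<in> ?O" for U
  proof -
    obtain C where C: "C \<in> Dhat m n" "U = orbit ?G ?\<phi> C" using U by (auto simp: orbits_def)
    obtain x where x: "x \<in> Dset m n" "C = shift_rel m n `` {x}"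
      using C(1) unfolding Dhat_def quotient_def by auto
    define A where "A = values_mset n x"
    have A: "A \<in> multiset_classes m n" using values_mset_image x(1) by (auto simp: A_def)
    have sub: "set_mset A \<subseteq> {..<m * n}"
      using A by (auto simp: multiset_classes_def multisets_of_size_def)
    have "V U = (\<lambda>j. rot m n j A) ` {..<n}"
    proof (intro equalityI subsetI)
      fix B assume "B \<in> V U"
      then obtain \<sigma> y where \<sigma>: "\<sigma> \<in> carrier ?G" and y: "y \<in> C" "B = values_mset n (y \<circ> inv' \<sigma>)"
        unfolding V_def C(2) orbit_def by (auto simp: act[OF C(1)])
      have p: "inv' \<sigma> permutes {1..n}" using \<sigma> by (simp add: sym_group_carrier permutes_inv)
      obtain j where "y = (shift m n ^^ j) x" using y(1) x(2) by (auto simp: shift_rel_def)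
      then have "B = rot m n j A"
        using y(2) values_mset_comp_permutes[OF p] values_mset_shift_pow[OF x(1)] by (simp add: A_def)
      also have "\<dots> = rot m n (j mod n) A" by (rule rot_cong) (simp add: cong_def)
      finally show "B \<in> (\<lambda>j. rot m n j A) ` {..<n}" using mn by auto
    next
      fix B assume "B \<in> (\<lambda>j. rot m n j A) ` {..<n}"
      then obtain j where "B = rot m n j A" by blast
      then have B: "B = values_mset n ((shift m n ^^ j) x)"
        using values_mset_shift_pow[OF x(1)] by (simp add: A_def)
      have "(shift m n ^^ j) x \<in> C"
        using x shift_pow_in_Dset[OF mn x(1)] by (auto simp: shift_rel_def)
      moreover have "C \<in> U" unfolding C(2) by (rule orbit_refl[OF C(1)])
      ultimately show "B \<in> V U" unfolding V_def B by blast
    qed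
    moreover have "inj_on (\<lambda>j. rot m n j A) {..<n}"
    proof (rule linorder_inj_onI)
      fix i j assume ij: "i < j" "i \<in> {..<n}" "j \<in> {..<n}"
      show "rot m n i A \<noteq> rot m n j A"
      proof
        assume eq: "rot m n i A = rot m n j A"
        \<comment> \<open>Rotating further by n - i makes the left side trivial, so rotation by j -
          i fixes A.\<close>
        have "rot m n (n - i + i) A = rot m n (n - i + j) A"
          unfolding rot_add[symmetric] eq ..
        moreover have "rot m n (n - i + i) A = rot m n 0 A"
          by (rule rot_cong) (use ij in \<open>simp add: cong_def\<close>)
        moreover have "n - i + j = n + (j - i)" using ij by auto
        then have "rot m n (n - i + j) A = rot m n (j - i) A"
          by (intro rot_cong) (simp add: cong_def)
        ultimately have "rot m n (j - i) A = A" using rot_0[OF sub] by simp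
        then have "n dvd j - i" by (rule rot_free[OF mn A])
        then show False using ij by (auto dest: dvd_imp_le)
      qed
    qed auto
    ultimately show ?thesis by (simp add: card_image)
  qed
  have finMC: "finite (multiset_classes m n)"
    unfolding multiset_classes_def by (simp add: finite_multisets_of_size)
  have inj: "inj_on V ?O"
  proof (rule inj_onI)
    fix U U' assume U: "U \<in> ?O" "U' \<in> ?O" and eq: "V U = V U'"
    have "V U \<noteq> {}" using cardV[OF U(1)] mn by auto
    then show "U = U'" using disj[OF U] eq by blast
  qed
  have finO: "finite ?O"
  proof (rule finite_imageD[OF _ inj])
    have "V ` ?O \<subseteq> Pow (multiset_classes m n)" using cover by blast
    then show "finite (V ` ?O)" using finMC by (simp add: finite_subset)
  qed
  have "card (multiset_classes m n) = card (\<Union>U\<in>?O. V U)" using cover by simp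
  also have "\<dots> = (\<Sum>U\<in>?O. card (V U))"
  proof (rule card_UN_disjoint[OF finO])
    show "\<forall>U\<in>?O. finite (V U)"
      using cover finMC by (metis Union_upper finite_subset image_eqI)
    show "\<forall>U\<in>?O. \<forall>U'\<in>?O. U \<noteq> U' \<longrightarrow> V U \<inter> V U' = {}" using disj by blast
  qed
  also have "\<dots> = n * card ?O" by (simp add: cardV)
  finally show ?thesis by simp
qed

text \<open>Reconciles three binomials: lower index d arises from the multiset count, m d from the
  stated formula, and d - 1 from the Euler product.\<close>

lemma choose_eq_mult_choose:
  assumes "d > 0"
  shows "((m + 1) * d - 1) choose d = m * (((m + 1) * d - 1) choose (m * d))"
    and "((m + 1) * d - 1) choose (m * d) = ((m + 1) * d - 1) choose (d - 1)"
proof -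
  obtain k where d: "d = Suc k" using assms gr0_implies_Suc by blast
  define q where "q = (m + 1) * d - 1"
  have q: "q = m * d + k" by (simp add: q_def d)
  show sym: "((m + 1) * d - 1) choose (m * d) = ((m + 1) * d - 1) choose (d - 1)"
    unfolding q_def[symmetric] using binomial_symmetric[of "m * d" q] by (simp add: q d)
  have qk: "q - k = m * d" and k: "k = d - 1" by (simp_all add: q d)
  have "d * (q choose d) = (q - k) * (q choose k)"
    unfolding d by (metis Suc_times_binomial_eq binomial_absorption binomial_absorb_comp mult.commute)
  also have "\<dots> = m * d * (q choose (d - 1))" unfolding qk using k by simp
  finally have "d * (q choose d) = d * (m * (q choose (d - 1)))" by (simp only: mult_ac)
  then have "q choose d = m * (q choose (d - 1))" using assms by simp
  then show "((m + 1) * d - 1) choose d = m * (((m + 1) * d - 1) choose (m * d))"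
    unfolding sym by (simp only: q_def)
qed

lemma card_orbits_Dhat_formula:
  assumes mn: "m \<ge> 1" "n \<ge> 1"
  shows "int (n ^ 2 * card (orbits (sym_group n) (Dhat m n) (coord_action_classes (Dhat m n)))) =
    (\<Sum>d | d dvd n. (-1) ^ (m * (n + d)) * moebius_mu (n div d) * int (((m + 1) * d - 1) choose (m * d)))"
    (is "int (n ^ 2 * ?o) = ?s")
proof -
  have "int m * int (n ^ 2 * ?o) = int (m * n * card (multiset_classes m n))"
    using card_orbits_Dhat[of m n] mn by (simp add: power2_eq_square flip: of_nat_mult)
  also have "\<dots> = (\<Sum>d | d dvd n. (-1) ^ (m * (n + d)) * moebius_mu (n div d) *
      int (((m + 1) * d - 1) choose d))"
    by (rule card_multiset_classes[OF mn])
  also have "\<dots> = (\<Sum>d | d dvd n. int m * ((-1) ^ (m * (n + d)) * moebius_mu (n div d) *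
      int (((m + 1) * d - 1) choose (m * d))))"
  proof (rule sum.cong[OF refl])
    fix d assume "d \<in> {d. d dvd n}"
    then have d: "d > 0" using mn by (auto intro: dvd_pos_nat)
    show "(-1) ^ (m * (n + d)) * moebius_mu (n div d) * int (((m + 1) * d - 1) choose d) =
        int m * ((-1) ^ (m * (n + d)) * moebius_mu (n div d) *
        int (((m + 1) * d - 1) choose (m * d)))"
      unfolding choose_eq_mult_choose(1)[OF d] of_nat_mult by (simp only: mult_ac)
  qed
  also have "\<dots> = int m * ?s" by (rule sum_distrib_left[symmetric])
  finally show ?thesis using mn by (simp only: mult_cancel_left) simp
qed

text \<open>Multiplying the orbit formula for k by (-1)^(m k) leaves signs that depend only on d. It
  then reads as a Moebius transform, whose inversion is the linear system for the
  invariants.\<close>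

lemma numerical_DT_eq_card_orbits:
  assumes mn: "m \<ge> 1" "n \<ge> 1"
  shows "numerical_DT m n =
    of_nat (card (orbits (sym_group n) (Dhat m n) (coord_action_classes (Dhat m n))))"
proof -
  define a where "a n = (if n = 0 then 0 else
    rat_of_nat (card (orbits (sym_group n) (Dhat m n) (coord_action_classes (Dhat m n)))))" for n
  define B where "B d = (-1) ^ (m * d) * rat_of_nat (((m + 1) * d - 1) choose (d - 1))" for d
  have a: "(-1) ^ (m * k) * of_nat (k ^ 2) * a k =
      (\<Sum>d | d dvd k. of_int (moebius_mu (k div d)) * B d)" if k: "k > 0" for k
  proof -
    have "of_nat (k ^ 2) * a k = rat_of_int (int (k ^ 2 *
        card (orbits (sym_group k) (Dhat m k) (coord_action_classes (Dhat m k)))))"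
      using k by (simp add: a_def)
    also have "\<dots> = (\<Sum>d | d dvd k. (-1) ^ (m * (k + d)) * of_int (moebius_mu (k div d)) *
        of_nat (((m + 1) * d - 1) choose (m * d)))"
      using k by (subst card_orbits_Dhat_formula[OF mn(1)]) simp_all
    finally have "(-1) ^ (m * k) * (of_nat (k ^ 2) * a k) =
      (\<Sum>d | d dvd k. (-1) ^ (m * k) * ((-1) ^ (m * (k + d)) * of_int (moebius_mu (k div d)) *
        of_nat (((m + 1) * d - 1) choose (m * d))))"
      by (simp only: sum_distrib_left)
    also have "\<dots> = (\<Sum>d | d dvd k. of_int (moebius_mu (k div d)) * B d)"
    proof (rule sum.cong[OF refl])
      fix d assume "d \<in> {d. d dvd k}"
      then have "d > 0" using k by (auto intro: dvd_pos_nat)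
      moreover have "(-1) ^ (m * k) * (-1) ^ (m * (k + d)) = ((-1) ^ (m * d) :: rat)"
        by (simp add: ring_distribs power_add flip: mult.assoc power_mult_distrib)
      ultimately show "(-1) ^ (m * k) * ((-1) ^ (m * (k + d)) * of_int (moebius_mu (k div d)) *
          rat_of_nat (((m + 1) * d - 1) choose (m * d))) = of_int (moebius_mu (k div d)) * B d"
        unfolding B_def choose_eq_mult_choose(2)[OF \<open>d > 0\<close>] by (simp add: mult_ac)
    qed
    finally show ?thesis by (simp only: mult.assoc)
  qed
  have "is_numerical_DT m a"
    unfolding is_numerical_DT_iff
  proof (intro allI impI)
    fix n :: nat assume n: "n > 0"
    have "(\<Sum>k | k dvd n. (-1) ^ (m * (k + n)) * of_nat (k ^ 2) * a k) =
        (-1) ^ (m * n) * (\<Sum>k | k dvd n. (-1) ^ (m * k) * of_nat (k ^ 2) * a k)"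
      by (simp add: sum_distrib_left ring_distribs power_add mult_ac)
    also have "\<dots> = (-1) ^ (m * n) * B n"
      using sum_dvd_moebius_sum[OF a n] by simp
    also have "\<dots> = rat_of_nat (((m + 1) * n - 1) choose (n - 1))"
      unfolding B_def by (simp flip: mult.assoc power_mult_distrib)
    finally show "(\<Sum>k | k dvd n. (-1) ^ (m * (k + n)) * of_nat (k ^ 2) * a k) =
        rat_of_nat (((m + 1) * n - 1) choose (n - 1))" .
  qed
  then have "numerical_DT m = a" by (intro numerical_DT_eqI) (simp_all add: a_def)
  then show ?thesis using mn by (simp add: a_def)
qed

theorem theorem3p7:
  fixes m n :: nat
  assumes "m \<ge> 1" and "n \<ge> 1"
  shows
    "reps_isomorphic (sym_group n)
       (free_space (Break m n))
       (perm_rep (sym_group n) (Break m n) (coord_action (Break m n)))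
       (free_space (Dhat m n))
       (perm_rep (sym_group n) (Dhat m n) (coord_action_classes (Dhat m n)))
   \<and>
    of_nat (card (orbits (sym_group n) (Break m n) (coord_action (Break m n)))) = numerical_DT m n
   \<and>
    (of_nat (card (orbits (sym_group n) (Dhat m n) (coord_action_classes (Dhat m n)))) :: rat) =
       1 / of_nat (n ^ 2) *
       (\<Sum>d | d dvd n. (-1) ^ (m * (n + d)) * of_int (moebius_mu (n div d)) *
          of_nat (((m + 1) * d - 1) choose (m * d)))
   \<and>
    reps_isomorphic ((sym_group n)\<lparr>carrier := {\<sigma> \<in> carrier (sym_group n). \<sigma> n = n}\<rparr>)
       (free_space (Break m n))
       (perm_rep (sym_group n) (Break m n) (coord_action (Break m n)))
       (free_space (Park m n))
       (perm_rep (sym_group (n - 1)) (Park m n) (coord_action (Park m n)))"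
proof (intro conjI)
  let ?o = "card (orbits (sym_group n) (Dhat m n) (coord_action_classes (Dhat m n)))"
  show "of_nat (card (orbits (sym_group n) (Break m n) (coord_action (Break m n)))) = numerical_DT m n"
    unfolding card_orbits_Break[OF assms] by (rule numerical_DT_eq_card_orbits[OF assms, symmetric])
  have "rat_of_nat (n ^ 2) * of_nat ?o = of_int (int (n ^ 2 * ?o))" by simp
  also have "\<dots> = (\<Sum>d | d dvd n. (-1) ^ (m * (n + d)) * of_int (moebius_mu (n div d)) *
      of_nat (((m + 1) * d - 1) choose (m * d)))"
    unfolding card_orbits_Dhat_formula[OF assms] by simp
  finally show "(of_nat ?o :: rat) = 1 / of_nat (n ^ 2) *
      (\<Sum>d | d dvd n. (-1) ^ (m * (n + d)) * of_int (moebius_mu (n div d)) *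
        of_nat (((m + 1) * d - 1) choose (m * d)))"
    using assms by (simp add: field_simps)
qed (rule reps_isomorphic_Break_Dhat[OF assms] reps_isomorphic_Break_Park[OF assms])+

end
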